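(* Fix $\varepsilon\in(0,1)$. The todolist data structure with parameter $\varepsilon$ (described in the context) supports inserting, deleting, and searching for a value using at most $\log_{2-\varepsilon} n + O(1)$ binary comparisons per operation, where $n$ is the number of values currently stored. Moreover, starting with an empty todolist and performing any sequence of $N$ insert and delete operations takes $O(\varepsilon^{-1}N\log N)$ total time.
   Context: A todolist with parameter $\varepsilon\in(0,1)$ storing values $x_1<\dots<x_n$ from a totally ordered set (accessed only through binary comparisons) consists of $h+1$ sorted singly-linked lists $L_0,\dots,L_h$, each headed by a sentinel node holding no data, where $\lceil\log_{2-\varepsilon} n\rceil\le h\le\lceil\log_{2-\varepsilon} n\rceil+1$, satisfying: (1) $|L_0|\le 1$; (2) $L_i\subseteq L_{i+1}$ for $0\le i<h$; (3) for each $1\le i\le h$ and each pair $x,y$ of consecutive elements of $L_i$, at least one of $x,y$ lies in $L_{i-1}$; (4) $L_h=\{x_1,\dots,x_n\}$. From the occurrence of a value (or sentinel) in $L_i$ one can reach its occurrence in $L_{i+1}$ in constant time. Search for $x$: starting at the sentinel of $L_0$, for $i=0,\dots,h$, move to the next node of $L_i$ if it exists and its key is $<x$ (one comparison), then go down to the corresponding node of $L_{i+1}$; this returns the predecessor of $x$ in $L_h$. Insert $x$: search, then splice $x$ into every $L_0,\dots,L_h$ right after the predecessors found. If now $|L_0|=2$, perform partial rebuilding: find the smallest $i$ with $|L_i|\le(2-\varepsilon)^i$ and rebuild $L_{i-1},L_{i-2},\dots,L_0$ in turn, each $L_{j-1}$ consisting of every second element of $L_j$ starting with the second. Delete $x$: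 search, splice $x$ out of all lists containing it, then splice $x$'s successor in $L_h$ (if any) into $L_0,\dots,L_{h-1}$, and perform partial rebuilding if $|L_0|=2$. Global rebuilding: if an insertion makes $n>\lceil(2-\varepsilon)^h\rceil$, increase $h$ by one, move $L_h$ to the new bottom list and partially rebuild all lists above it; if an update makes $\sum_i|L_i|>cn$ for a fixed constant $c>2$, rebuild $L_0,\dots,L_{h-1}$ by the partial rebuilding procedure; if a deletion makes $n<\lceil(2-\varepsilon)^{h-2}\rceil$, decrease $h$ by one, move $L_h$ to $L_{h-1}$ and partially rebuild the lists above it.
   Formalization: The stated update rules do not keep h exactly in its range (nor always give a rebuild index; then all lists above L_h are rebuilt), so reachable lists satisfy (1)–(4) with h within O(1) of log n; their O-constants are uniform for ε ≤ ε₀, any ε₀ < 1, as uniformity for ε near 1 fails. *)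

theory Defs
  imports "HOL-Analysis.Analysis" "HOL-Library.Monad_Syntax"
begin

text \<open>
  A run of an algorithm yields a result, the number of binary comparisons of keys that it made,
  and its running time in elementary steps. A comparison also takes one elementary step.
\<close>

datatype 'r run = Run (result: 'r) (comparisons: nat) (time: nat)

definition ret :: "'r \<Rightarrow> 'r run" where
  "ret r = Run r 0 0"

definition bind_run :: "'r run \<Rightarrow> ('r \<Rightarrow> 's run) \<Rightarrow> 's run" where
  "bind_run m f =
     Run (result (f (result m)))
         (comparisons m + comparisons (f (result m)))
         (time m + time (f (result m)))"

adhoc_overloading Monad_Syntax.bind \<rightleftharpoons> bind_run

definition tick :: "nat \<Rightarrow> unit run" where
  "tick k = Run () 0 k"

definition key_less :: "'a::linorder \<Rightarrow> 'a \<Rightarrow> bool run" where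
  "key_less x y = Run (x < y) 1 1"

text \<open>
  The lists are kept as \<open>Ls = [L\<^sub>0, \<dots>, L\<^sub>h]\<close>. Each \<open>L\<^sub>i\<close> lists the keys of its data nodes in
  order. As keys are distinct within a list, a node of \<open>L\<^sub>i\<close> is named by an option: \<^const>\<open>None\<close> is
  the sentinel and \<open>Some v\<close> the node holding \<open>v\<close>. The node below it, in \<open>L\<^bsub>i+1\<^esub>\<close>, has the same name.
  Testing node names for equality is pointer equality and not a comparison of keys. Following or
  redirecting a pointer of a known node is an elementary step; so is reading a stored counter
  (\<open>n\<close>, \<open>|L\<^sub>i|\<close>, the sum of the \<open>|L\<^sub>i|\<close>).
\<close>

definition height :: "'a list list \<Rightarrow> nat" where
  "height Ls = length Ls - 1"

definition layered :: "'a::linorder set \<Rightarrow> 'a list list \<Rightarrow> bool" where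
  "layered S Ls \<longleftrightarrow>
     Ls \<noteq> [] \<and>
     (\<forall>L \<in> set Ls. sorted_wrt (<) L) \<and>
     length (Ls ! 0) \<le> 1 \<and>
     (\<forall>i < height Ls. set (Ls ! i) \<subseteq> set (Ls ! (i + 1))) \<and>
     (\<forall>i. 1 \<le> i \<and> i \<le> height Ls \<longrightarrow>
        (\<forall>k. k + 1 < length (Ls ! i) \<longrightarrow>
           Ls ! i ! k \<in> set (Ls ! (i - 1)) \<or> Ls ! i ! (k + 1) \<in> set (Ls ! (i - 1)))) \<and>
     set (Ls ! height Ls) = S"

text \<open>For \<open>n = 0\<close> the library convention \<^term>\<open>log b 0 = 0\<close> makes the height \<open>0\<close> or \<open>1\<close>.\<close>

definition todolist :: "real \<Rightarrow> 'a::linorder set \<Rightarrow> 'a list list \<Rightarrow> bool" where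
  "todolist \<epsilon> S Ls \<longleftrightarrow>
     layered S Ls \<and>
     \<lceil>log (2 - \<epsilon>) (real (card S))\<rceil> \<le> int (height Ls) \<and>
     int (height Ls) \<le> \<lceil>log (2 - \<epsilon>) (real (card S))\<rceil> + 1"

definition predecessor :: "'a::linorder set \<Rightarrow> 'a \<Rightarrow> 'a option" where
  "predecessor S x =
     (if \<exists>v\<in>S. v < x then Some (Max {v \<in> S. v < x}) else None)"


fun nodes_after :: "'a list \<Rightarrow> 'a option \<Rightarrow> 'a list" where
  "nodes_after L None = L"
| "nodes_after L (Some u) = tl (dropWhile (\<lambda>v. v \<noteq> u) L)"

definition next_node :: "'a list \<Rightarrow> 'a option \<Rightarrow> 'a option" where
  "next_node L u = (case nodes_after L u of [] \<Rightarrow> None | v # _ \<Rightarrow> Some v)"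

fun nodes_upto :: "'a list \<Rightarrow> 'a option \<Rightarrow> 'a list" where
  "nodes_upto L None = []"
| "nodes_upto L (Some u) = takeWhile (\<lambda>v. v \<noteq> u) L @ [u]"

definition splice_in :: "'a \<Rightarrow> 'a option \<Rightarrow> 'a list \<Rightarrow> 'a list" where
  "splice_in x u L =
     (if next_node L u = Some x then L else nodes_upto L u @ x # nodes_after L u)"

definition splice_out :: "'a \<Rightarrow> 'a option \<Rightarrow> 'a list \<Rightarrow> 'a list" where
  "splice_out x u L =
     (if next_node L u = Some x then nodes_upto L u @ tl (nodes_after L u) else L)"


definition advance :: "'a::linorder \<Rightarrow> 'a list \<Rightarrow> 'a option \<Rightarrow> 'a option run" where
  "advance x L u = do {
     tick 1;
     case next_node L u of
       None \<Rightarrow> ret u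
     | Some v \<Rightarrow> do { b \<leftarrow> key_less v x; ret (if b then Some v else u) }
   }"

primrec search_path ::
  "'a::linorder \<Rightarrow> 'a list list \<Rightarrow> 'a option \<Rightarrow> 'a option list run" where
  "search_path x [] u = ret []"
| "search_path x (L # Ls) u = do {
     u' \<leftarrow> advance x L u;
     us \<leftarrow> search_path x Ls u';
     ret (u' # us)
   }"

definition search :: "'a::linorder \<Rightarrow> 'a list list \<Rightarrow> 'a option run" where
  "search x Ls = do { us \<leftarrow> search_path x Ls None; ret (last us) }"

text \<open>
  For \<open>v\<close> the node following the predecessor of \<open>x\<close> in \<open>L\<^sub>h\<close> we have \<open>x \<le> v\<close>, so that one further
  comparison decides whether \<open>x\<close> is stored.
\<close>

definition holds_key :: "'a::linorder \<Rightarrow> 'a option \<Rightarrow> bool run" where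
  "holds_key x node =
     (case node of None \<Rightarrow> ret False | Some v \<Rightarrow> do { b \<leftarrow> key_less x v; ret (\<not> b) })"


fun every_second :: "'a list \<Rightarrow> 'a list run" where
  "every_second [] = ret []"
| "every_second [x] = do { tick 1; ret [] }"
| "every_second (x # y # zs) = do { tick 2; ys \<leftarrow> every_second zs; ret (y # ys) }"

text \<open>From \<open>L = L\<^sub>i\<close> produce \<open>[L\<^sub>0, \<dots>, L\<^sub>i]\<close>.\<close>

primrec rebuild :: "nat \<Rightarrow> 'a list \<Rightarrow> 'a list list run" where
  "rebuild 0 L = ret [L]"
| "rebuild (Suc i) L = do {
     tick 1;
     M \<leftarrow> every_second L;
     Ms \<leftarrow> rebuild i M;
     ret (Ms @ [L])
   }"

text \<open>
  An index \<open>i\<close> with \<open>|L\<^sub>i| \<le> (2 - \<epsilon>)\<^sup>i\<close> may fail to exist: the global rebuilding rule tolerates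
  \<open>n \<le> \<lceil>(2 - \<epsilon>)\<^sup>h\<rceil>\<close>, and for small \<open>n\<close> and \<open>\<epsilon>\<close> near \<open>1\<close> the height, which grows by one per
  insertion, may lag behind further. Then everything above \<open>L\<^sub>h\<close> is rebuilt.
\<close>

definition rebuild_level :: "real \<Rightarrow> 'a list list \<Rightarrow> nat" where
  "rebuild_level \<epsilon> Ls =
     (if \<exists>i \<le> height Ls. real (length (Ls ! i)) \<le> (2 - \<epsilon>) ^ i
      then LEAST i. i \<le> height Ls \<and> real (length (Ls ! i)) \<le> (2 - \<epsilon>) ^ i
      else height Ls)"

definition partial_rebuild :: "real \<Rightarrow> 'a list list \<Rightarrow> 'a list list run" where
  "partial_rebuild \<epsilon> Ls = do {
     tick 1;
     if length (Ls ! 0) = 2 then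
       let i = rebuild_level \<epsilon> Ls in do {
         tick (i + 1);
         Ms \<leftarrow> rebuild i (Ls ! i);
         ret (Ms @ drop (i + 1) Ls)
       }
     else ret Ls
   }"

definition grow :: "real \<Rightarrow> 'a list list \<Rightarrow> 'a list list run" where
  "grow \<epsilon> Ls = do {
     tick 1;
     let h = height Ls; L = Ls ! h in
       if int (length L) > \<lceil>(2 - \<epsilon>) ^ h\<rceil> then rebuild (h + 1) L else ret Ls
   }"

definition shrink :: "real \<Rightarrow> 'a list list \<Rightarrow> 'a list list run" where
  "shrink \<epsilon> Ls = do {
     tick 1;
     let h = height Ls; L = Ls ! h in
       if h > 0 \<and> int (length L) < \<lceil>(2 - \<epsilon>) powi (int h - 2)\<rceil>
       then rebuild (h - 1) L else ret Ls
   }"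

definition slim :: "real \<Rightarrow> 'a list list \<Rightarrow> 'a list list run" where
  "slim c Ls = do {
     tick 1;
     let h = height Ls; L = Ls ! h in
       if real (\<Sum>i\<le>h. length (Ls ! i)) > c * real (length L)
       then rebuild h L else ret Ls
   }"

text \<open>
  Inserting a stored value or deleting a value that is not stored leaves the lists unchanged.
\<close>

definition insert_key ::
  "real \<Rightarrow> real \<Rightarrow> 'a::linorder \<Rightarrow> 'a list list \<Rightarrow> 'a list list run" where
  "insert_key \<epsilon> c x Ls = do {
     us \<leftarrow> search_path x Ls None;
     stored \<leftarrow> holds_key x (next_node (last Ls) (last us));
     if stored then ret Ls
     else do {
       tick (length Ls);
       Ls \<leftarrow> partial_rebuild \<epsilon> (map2 (splice_in x) us Ls);
       Ls \<leftarrow> grow \<epsilon> Ls;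
       slim c Ls
     }
   }"

definition delete_key ::
  "real \<Rightarrow> real \<Rightarrow> 'a::linorder \<Rightarrow> 'a list list \<Rightarrow> 'a list list run" where
  "delete_key \<epsilon> c x Ls = do {
     us \<leftarrow> search_path x Ls None;
     stored \<leftarrow> holds_key x (next_node (last Ls) (last us));
     if \<not> stored then ret Ls
     else do {
       tick (2 * length Ls);
       let Ms = map2 (splice_out x) us Ls;
       let Ns = (case next_node (last Ls) (Some x) of
                   None \<Rightarrow> Ms
                 | Some y \<Rightarrow> map2 (splice_in y) (butlast us) (butlast Ms) @ [last Ms]);
       Ls \<leftarrow> partial_rebuild \<epsilon> Ns;
       Ls \<leftarrow> shrink \<epsilon> Ls;
       slim c Ls
     }
   }"


datatype 'a op = Insert 'a | Delete 'a

primrec perform ::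
  "real \<Rightarrow> real \<Rightarrow> 'a::linorder op \<Rightarrow> 'a list list \<Rightarrow> 'a list list run" where
  "perform \<epsilon> c (Insert x) Ls = insert_key \<epsilon> c x Ls"
| "perform \<epsilon> c (Delete x) Ls = delete_key \<epsilon> c x Ls"

primrec perform_all ::
  "real \<Rightarrow> real \<Rightarrow> 'a::linorder op list \<Rightarrow> 'a list list \<Rightarrow> 'a list list run" where
  "perform_all \<epsilon> c [] Ls = ret Ls"
| "perform_all \<epsilon> c (p # ps) Ls = do { Ls' \<leftarrow> perform \<epsilon> c p Ls; perform_all \<epsilon> c ps Ls' }"

primrec update_values :: "'a op \<Rightarrow> 'a set \<Rightarrow> 'a set" where
  "update_values (Insert x) S = insert x S"
| "update_values (Delete x) S = S - {x}"

definition values_after :: "'a op list \<Rightarrow> 'a set" where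
  "values_after ps = fold update_values ps {}"

definition empty_todolist :: "'a list list" where
  "empty_todolist = [[]]"

text \<open>
  Every operation on \<open>Ls\<close>, which stores \<open>S\<close>, is correct and makes at most \<open>B\<close> comparisons.
\<close>

definition supports_within ::
  "real \<Rightarrow> real \<Rightarrow> real \<Rightarrow> 'a::linorder set \<Rightarrow> 'a list list \<Rightarrow> bool" where
  "supports_within \<epsilon> c B S Ls \<longleftrightarrow>
     (\<forall>x. result (search x Ls) = predecessor S x \<and>
          layered (insert x S) (result (insert_key \<epsilon> c x Ls)) \<and>
          layered (S - {x}) (result (delete_key \<epsilon> c x Ls)) \<and>
          real (comparisons (search x Ls)) \<le> B \<and>
          real (comparisons (insert_key \<epsilon> c x Ls)) \<le> B \<and>
          real (comparisons (delete_key \<epsilon> c x Ls)) \<le> B)"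

end

theory Submission
  imports Defs
begin

text \<open>
  Write \<open>b = 2 - \<epsilon>\<close>. Property (3) leaves at most one node of \<open>L\<^sub>i\<close> between the predecessor
  of \<open>x\<close> in \<open>L\<^bsub>i-1\<^esub>\<close> and \<open>x\<close>, so one comparison per level suffices and only the height matters.
  Layering survives every operation as long as \<open>n \<le> 2\<^sup>h\<close>, and global rebuilding keeps \<open>h\<close> within a
  constant of \<open>log\<^sub>b n\<close>.

  For the running time, take \<open>\<epsilon>\<^sup>-\<^sup>1 \<Sum> |L\<^sub>i|\<close> as a potential, up to a constant factor. By property (3),
  \<open>|L\<^bsub>i-1\<^esub>| \<ge> \<lfloor>|L\<^sub>i| / 2\<rfloor>\<close>, hence rebuilding never lengthens a list. Partial rebuilding from level \<open>i\<close>
  takes time proportional to \<open>|L\<^sub>i| \<le> b\<^sup>i\<close> and shortens \<open>L\<^bsub>i-1\<^esub>\<close>, which had more than \<open>b\<^bsup>i-1\<^esup>\<close>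
  nodes, to at most \<open>b\<^sup>i / 2 = (1 - \<epsilon> / 2) b\<^bsup>i-1\<^esup>\<close> nodes; the drop of the potential pays for it.
  Changes of height are paid for by a second potential, proportional to \<open>|n - b\<^bsup>h-1\<^esup>|\<close>.
  Every update thus has amortized time \<open>O(h / \<epsilon>)\<close>.
\<close>

lemma run_simps [simp]:
  "result (ret r) = r" "comparisons (ret r) = 0" "time (ret r) = 0"
  "result (bind_run m f) = result (f (result m))"
  "comparisons (bind_run m f) = comparisons m + comparisons (f (result m))"
  "time (bind_run m f) = time m + time (f (result m))"
  "comparisons (tick k) = 0" "time (tick k) = k"
  "result (key_less x y) = (x < y)" "comparisons (key_less x y) = 1" "time (key_less x y) = 1"
  by (simp_all add: ret_def bind_run_def tick_def key_less_def)

subsection \<open>Layers\<close>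

text \<open>Properties (2) and (3) for two adjacent lists. As a binary relation they turn the whole
  structure into a \<open>successively\<close> chain, which can be cut and glued by append lemmas
  instead of indices.\<close>

definition halves :: "'a list \<Rightarrow> 'a list \<Rightarrow> bool" where
  "halves M L \<longleftrightarrow> set M \<subseteq> set L \<and> successively (\<lambda>v w. v \<in> set M \<or> w \<in> set M) L"

text \<open>This is \<open>layered\<close> without the bound on the top list, which may fail between
  splicing and partial rebuilding.\<close>

definition stacked :: "'a::linorder set \<Rightarrow> 'a list list \<Rightarrow> bool" where
  "stacked S Ls \<longleftrightarrow>
     Ls \<noteq> [] \<and> (\<forall>L\<in>set Ls. sorted_wrt (<) L) \<and> successively halves Ls \<and> set (last Ls) = S"

lemma nth_height: "Ls \<noteq> [] \<Longrightarrow> Ls ! height Ls = last Ls"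
  by (simp add: height_def last_conv_nth)

lemma length_eq_height: "Ls \<noteq> [] \<Longrightarrow> length Ls = Suc (height Ls)"
  by (simp add: height_def)

lemma height_less_iff: "i < height Ls \<longleftrightarrow> Suc i < length Ls"
  by (auto simp: height_def)

lemma layered_iff: "layered S Ls \<longleftrightarrow> stacked S Ls \<and> length (hd Ls) \<le> 1"
proof (cases "Ls = []")
  case False
  have "(\<forall>i < height Ls. set (Ls ! i) \<subseteq> set (Ls ! (i + 1))) \<and>
     (\<forall>i. 1 \<le> i \<and> i \<le> height Ls \<longrightarrow>
        (\<forall>k. k + 1 < length (Ls ! i) \<longrightarrow>
           Ls ! i ! k \<in> set (Ls ! (i - 1)) \<or> Ls ! i ! (k + 1) \<in> set (Ls ! (i - 1))))
     \<longleftrightarrow> (\<forall>i < height Ls. halves (Ls ! i) (Ls ! Suc i))" (is "?A \<and> ?B \<longleftrightarrow> ?C")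
  proof -
    have "?B \<longleftrightarrow> (\<forall>i < height Ls. \<forall>k. k + 1 < length (Ls ! Suc i) \<longrightarrow>
           Ls ! Suc i ! k \<in> set (Ls ! i) \<or> Ls ! Suc i ! (k + 1) \<in> set (Ls ! i))" (is "_ \<longleftrightarrow> ?B'")
    proof
      assume B: ?B
      show ?B'
      proof (intro allI impI)
        fix i k assume "i < height Ls" "k + 1 < length (Ls ! Suc i)"
        then show "Ls ! Suc i ! k \<in> set (Ls ! i) \<or> Ls ! Suc i ! (k + 1) \<in> set (Ls ! i)"
          using B[rule_format, of "Suc i" k] by simp
      qed
    next
      assume B: ?B'
      show ?B
      proof (intro allI impI)
        fix i k assume "1 \<le> i \<and> i \<le> height Ls" "k + 1 < length (Ls ! i)"
        then show "Ls ! i ! k \<in> set (Ls ! (i - 1)) \<or> Ls ! i ! (k + 1) \<in> set (Ls ! (i - 1))"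
          using B[rule_format, of "i - 1" k] by (cases i) auto
      qed
    qed
    then show ?thesis
      by (auto simp: halves_def successively_conv_nth)
  qed
  then show ?thesis
    unfolding layered_def stacked_def successively_conv_nth
    using False by (auto simp: nth_height hd_conv_nth height_less_iff)
qed (simp add: layered_def stacked_def)

lemma stacked_card: "stacked S Ls \<Longrightarrow> card S = length (last Ls)"
  by (auto simp: stacked_def strict_sorted_iff distinct_card)

lemma stacked_subset:
  assumes "successively halves Ls" "L \<in> set Ls"
  shows "set L \<subseteq> set (last Ls)"
  using assms
proof (induction Ls rule: rev_induct)
  case (snoc M Ls)
  then show ?case
    by (auto simp: successively_append_iff halves_def split: if_splits dest: subsetD)
qed simp

text \<open>Group the list into disjoint pairs of neighbours: each pair contains an element of
  \<open>A\<close>, and at most one element is left over.\<close>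

lemma length_div_2_le_filter:
  "successively (\<lambda>v w. v \<in> A \<or> w \<in> A) L \<Longrightarrow> length L div 2 \<le> length (filter (\<lambda>v. v \<in> A) L)"
proof (induction L rule: induct_list012)
  case (3 v w L)
  then have "successively (\<lambda>v w. v \<in> A \<or> w \<in> A) L"
    by (cases L) auto
  with 3 show ?case by auto
qed auto

lemma halves_length:
  assumes "halves M L" "distinct L"
  shows "length L div 2 \<le> length M"
proof -
  have "length L div 2 \<le> length (filter (\<lambda>v. v \<in> set M) L)"
    using assms by (intro length_div_2_le_filter) (simp add: halves_def)
  also have "\<dots> = card (set (filter (\<lambda>v. v \<in> set M) L))"
    using assms by (simp add: distinct_card del: set_filter)
  also have "\<dots> \<le> card (set M)"
    by (intro card_mono) auto
  also have "\<dots> \<le> length M" by (rule card_length)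
  finally show ?thesis .
qed

section \<open>Cutting and replacing in sorted lists\<close>

lemma filter_less_append:
  "sorted_wrt (<) (L :: 'a::linorder list) \<Longrightarrow>
    filter (\<lambda>v. v < x) L @ filter (\<lambda>v. \<not> v < x) L = L"
proof (induction L)
  case (Cons v L)
  show ?case
  proof (cases "v < x")
    case False
    with Cons.prems have "filter (\<lambda>v. v < x) L = []" by (auto simp: filter_empty_conv)
    with False Cons show ?thesis by auto
  qed (use Cons in auto)
qed simp

lemma filter_le_append:
  "sorted_wrt (<) (L :: 'a::linorder list) \<Longrightarrow>
    filter (\<lambda>v. \<not> x < v) L @ filter (\<lambda>v. x < v) L = L"
proof (induction L)
  case (Cons v L)
  show ?case
  proof (cases "x < v")
    case True
    with Cons.prems have "filter (\<lambda>v. \<not> x < v) L = []" by (auto simp: filter_empty_conv)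
    with True Cons show ?thesis by auto
  qed (use Cons in auto)
qed simp

lemma filter_not_less:
  "x \<notin> set L \<Longrightarrow> filter (\<lambda>v. \<not> v < x) L = filter (\<lambda>v. (x::'a::linorder) < v) L"
  by (intro filter_cong) (auto simp: not_less order.order_iff_strict)

text \<open>One form for both updates: \<open>replace x x\<close> inserts \<open>x\<close> into a
  list without it; with \<open>y\<close> the successor of \<open>x\<close>,
  \<open>replace x y\<close> deletes \<open>x\<close> and makes sure that \<open>y\<close> is
  present.\<close>

definition replace :: "'a::linorder \<Rightarrow> 'a \<Rightarrow> 'a list \<Rightarrow> 'a list" where
  "replace x y L = filter (\<lambda>v. v < x) L @ y # filter (\<lambda>v. y < v) L"

lemma
  fixes L :: "'a::linorder list"
  assumes "sorted_wrt (<) L" "successively P L"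
  shows successively_filter_less: "successively P (filter (\<lambda>v. v < x) L)"
    and successively_filter_greater: "successively P (filter (\<lambda>v. x < v) L)"
  using assms filter_less_append[of L x] filter_le_append[of L x]
  by (metis successively_append_iff)+

text \<open>A pair of neighbours in the new lower list either contains \<open>y\<close>, which now
  lies in both lists, or it lies on one side of \<open>y\<close> and was a pair of neighbours in
  \<open>L\<close> before.\<close>

lemma halves_replace:
  assumes "halves M L" "sorted_wrt (<) L"
  shows "halves (replace x y M) (replace x y L)"
proof -
  let ?P = "\<lambda>v w. v \<in> set (replace x y M) \<or> w \<in> set (replace x y M)"
  have s: "successively (\<lambda>v w. v \<in> set M \<or> w \<in> set M) L"
    using assms by (simp add: halves_def)
  have "successively ?P (filter (\<lambda>v. v < x) L)"
    by (rule successively_mono[OF successively_filter_less[OF assms(2) s]])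
       (auto simp: replace_def)
  moreover have "successively ?P (filter (\<lambda>v. y < v) L)"
    by (rule successively_mono[OF successively_filter_greater[OF assms(2) s]])
       (auto simp: replace_def)
  moreover have "?P v y" "?P y v" for v
    by (auto simp: replace_def)
  ultimately have "successively ?P (replace x y L)"
    unfolding replace_def[of x y L] by (auto simp: successively_append_iff successively_Cons)
  moreover have "set (replace x y M) \<subseteq> set (replace x y L)"
    using assms by (auto simp: replace_def halves_def)
  ultimately show ?thesis by (simp add: halves_def)
qed

lemma halves_filter_less:
  assumes "halves M L" "sorted_wrt (<) (L :: 'a::linorder list)"
  shows "halves (filter (\<lambda>v. v < x) M) (filter (\<lambda>v. v < x) L)"
proof -
  have s: "successively (\<lambda>v w. v \<in> set M \<or> w \<in> set M) L"
    using assms by (simp add: halves_def)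
  have "successively (\<lambda>v w. v \<in> set (filter (\<lambda>v. v < x) M) \<or> w \<in> set (filter (\<lambda>v. v < x) M))
     (filter (\<lambda>v. v < x) L)"
    by (rule successively_mono[OF successively_filter_less[OF assms(2) s]]) auto
  then show ?thesis using assms by (auto simp: halves_def)
qed

lemma sorted_replace:
  "sorted_wrt (<) L \<Longrightarrow> x \<le> y \<Longrightarrow> sorted_wrt (<) (replace x y L)"
  by (force simp: replace_def sorted_wrt_append sorted_wrt_filter)

lemma length_replace:
  assumes "x \<le> y" shows "length (replace x y L) \<le> length L + 1"
proof -
  have "length (filter (\<lambda>v. y < v) L) \<le> length (filter (\<lambda>v. \<not> v < x) L)"
    using assms by (induction L) auto
  then show ?thesis
    using sum_length_filter_compl[of "\<lambda>v. v < x" L] by (simp add: replace_def)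
qed

text \<open>Each update amounts to a single function applied on every level, so that it suffices to
  check two adjacent lists.\<close>

lemma stacked_map:
  assumes "stacked S Ls"
    and "\<And>M L. halves M L \<Longrightarrow> sorted_wrt (<) L \<Longrightarrow> halves (f M) (f L)"
    and "\<And>L. sorted_wrt (<) L \<Longrightarrow> sorted_wrt (<) (f L)"
  shows "stacked (set (f (last Ls))) (map f Ls)"
  unfolding stacked_def successively_map using assms
  by (auto simp: stacked_def last_map elim!: successively_mono)

subsection \<open>Searching\<close>

lemma predecessor_eq_filter:
  assumes "sorted_wrt (<) L"
  shows "predecessor (set L) x =
    (if filter (\<lambda>v. v < x) L = [] then None else Some (last (filter (\<lambda>v. v < x) L)))"
proof (cases "filter (\<lambda>v. v < x) L = []")
  case True
  then show ?thesis by (auto simp: predecessor_def filter_empty_conv)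
next
  case False
  let ?P = "filter (\<lambda>v. v < x) L"
  have "sorted ?P" using sorted_wrt_filter[OF assms] by (simp add: strict_sorted_iff)
  have "v \<le> last ?P" if "v \<in> set ?P" for v
    using that \<open>sorted ?P\<close> by (cases ?P rule: rev_cases) (auto simp: sorted_append)
  moreover have "last ?P \<in> set ?P" using False by (rule last_in_set)
  ultimately have "Max (set ?P) = last ?P" by (intro Max_eqI) auto
  then have "Max {v \<in> set L. v < x} = last ?P" by simp
  moreover have "\<exists>v\<in>set L. v < x" using False by (auto simp: filter_empty_conv)
  ultimately show ?thesis using False by (simp add: predecessor_def)
qed

lemma
  assumes "distinct (P @ u # Q)"
  shows nodes_after_Some: "nodes_after (P @ u # Q) (Some u) = Q"
    and nodes_upto_Some: "nodes_upto (P @ u # Q) (Some u) = P @ [u]"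
proof -
  have "\<forall>v\<in>set P. v \<noteq> u" using assms by auto
  then show "nodes_after (P @ u # Q) (Some u) = Q" "nodes_upto (P @ u # Q) (Some u) = P @ [u]"
    by (simp_all add: dropWhile_append2 takeWhile_append2)
qed

lemma
  assumes "sorted_wrt (<) L"
  shows nodes_after_predecessor:
      "nodes_after L (predecessor (set L) x) = filter (\<lambda>v. \<not> v < x) L" (is ?A)
    and nodes_upto_predecessor:
      "nodes_upto L (predecessor (set L) x) = filter (\<lambda>v. v < x) L" (is ?B)
proof -
  have "?A \<and> ?B"
  proof (cases "filter (\<lambda>v. v < x) L = []")
    case True
    then have "filter (\<lambda>v. \<not> v < x) L = L"
      by (metis append_Nil filter_less_append[OF assms])
    with True assms show ?thesis by (simp add: predecessor_eq_filter)
  next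
    case False
    let ?P = "filter (\<lambda>v. v < x) L" and ?Q = "filter (\<lambda>v. \<not> v < x) L"
    have L: "L = butlast ?P @ last ?P # ?Q"
      using False filter_less_append[OF assms, of x] append_butlast_last_id[OF False]
      by (metis append.assoc append_Cons append_Nil)
    moreover have "distinct L" using assms by (simp add: strict_sorted_iff)
    ultimately have "nodes_after L (Some (last ?P)) = ?Q"
      "nodes_upto L (Some (last ?P)) = butlast ?P @ [last ?P]"
      using nodes_after_Some[of "butlast ?P" "last ?P" ?Q]
        nodes_upto_Some[of "butlast ?P" "last ?P" ?Q] by metis+
    with False assms show ?thesis by (simp add: predecessor_eq_filter)
  qed
  then show ?A ?B by auto
qed

lemma nodes_after_member:
  assumes "sorted_wrt (<) (L :: 'a::linorder list)" "x \<in> set L"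
  shows "nodes_after L (Some x) = filter (\<lambda>v. x < v) L"
proof -
  obtain P Q where L: "L = P @ x # Q" using assms(2) by (meson split_list)
  then have "filter (\<lambda>v. x < v) L = Q"
    using assms(1) by (auto simp: sorted_wrt_append filter_id_conv filter_empty_conv)
  moreover have "nodes_after L (Some x) = Q"
    using L assms nodes_after_Some[of P x Q] by (simp add: strict_sorted_iff)
  ultimately show ?thesis by simp
qed

text \<open>
  If the predecessor of \<open>x\<close> in \<open>M\<close> is at hand, then at most one node of \<open>L\<close> lies strictly between
  it and \<open>x\<close>, as two such nodes would be consecutive nodes of \<open>L\<close> that \<open>M\<close> skips.
\<close>

lemma advance_predecessor:
  assumes "halves M L" "sorted_wrt (<) L" "sorted_wrt (<) M"
  shows "result (advance x L (predecessor (set M) x)) = predecessor (set L) x"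
proof -
  let ?P = "filter (\<lambda>v. v < x) L" and ?Q = "filter (\<lambda>v. \<not> v < x) L"
  define u where "u = predecessor (set M) x"
  have L: "L = ?P @ ?Q" using filter_less_append[OF assms(2)] by simp
  \<comment> \<open>\<open>P2\<close> holds the nodes of \<open>L\<close> after \<open>u\<close> and
    below \<open>x\<close>. None of them lies in \<open>M\<close>, so at most one exists; if there
    is none, \<open>u\<close> is already the answer.\<close>
  obtain P1 P2 where P: "?P = P1 @ P2" and na: "nodes_after L u = P2 @ ?Q"
    and M: "\<forall>v\<in>set P2. v \<notin> set M" and e: "P2 = [] \<Longrightarrow> u = predecessor (set L) x"
  proof (cases "\<exists>v\<in>set M. v < x")
    case False
    then have "u = None" by (auto simp: u_def predecessor_def)
    moreover have "?P = [] \<Longrightarrow> predecessor (set L) x = None"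
      by (simp add: predecessor_eq_filter[OF assms(2)])
    ultimately show ?thesis using that[of "[]" ?P] L False by auto
  next
    case True
    define w where "w = Max {v \<in> set M. v < x}"
    have u: "u = Some w" using True by (auto simp: u_def predecessor_def w_def)
    have "w \<in> {v \<in> set M. v < x}" unfolding w_def by (rule Max_in) (use True in auto)
    then have w: "w \<in> set M" "w < x" by auto
    have max: "v \<le> w" if "v \<in> set M" "v < x" for v
      unfolding w_def using that by (intro Max_ge) auto
    have "w \<in> set ?P" using w assms(1) by (auto simp: halves_def)
    then obtain P1 P2 where P: "?P = P1 @ w # P2" by (meson split_list)
    have sP: "sorted_wrt (<) ?P" using assms(2) by (rule sorted_wrt_filter)
    have gt: "w < v" if "v \<in> set P2" for v
      using sP that unfolding P by (auto simp: sorted_wrt_append)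
    have lt: "v < x" if "v \<in> set P2" for v
      using that P by (metis (no_types, lifting) Un_iff filter_is_subset in_set_conv_decomp list.set_intros(2) mem_Collect_eq set_append set_filter)
    have "nodes_after L u = P2 @ ?Q"
    proof -
      have L': "L = P1 @ w # (P2 @ ?Q)" using L P by simp
      moreover have "distinct L" using assms(2) by (simp add: strict_sorted_iff)
      ultimately show ?thesis using nodes_after_Some[of P1 w "P2 @ ?Q"] u by metis
    qed
    moreover have "\<forall>v\<in>set P2. v \<notin> set M" using gt lt max by (meson linorder_not_le)
    moreover have "P2 = [] \<Longrightarrow> u = predecessor (set L) x"
      by (simp add: predecessor_eq_filter[OF assms(2)] P u)
    ultimately show ?thesis using that[of "P1 @ [w]" P2] P by auto
  qed
  have "successively (\<lambda>v w. v \<in> set M \<or> w \<in> set M) ?P"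
    using assms by (intro successively_filter_less) (auto simp: halves_def)
  then have s: "successively (\<lambda>v w. v \<in> set M \<or> w \<in> set M) P2"
    using P by (simp add: successively_append_iff)
  show ?thesis
  proof (cases P2)
    case Nil
    have "\<not> v < x" if "next_node L u = Some v" for v
    proof -
      have "nodes_after L u = ?Q" using na Nil by simp
      with that have "v \<in> set ?Q"
        unfolding next_node_def by (metis (no_types, lifting) list.case_eq_if list.set_sel(1) option.inject option.simps(3))
      then show ?thesis by simp
    qed
    then show ?thesis
      using e Nil by (auto simp: advance_def u_def[symmetric] split: option.split)
  next
    case (Cons p P3)
    with s M have "P3 = []" by (cases P3) auto
    with Cons have P2: "P2 = [p]" by simp
    have "p \<in> set ?P" using P P2 by simp
    then have "p < x" by simp
    moreover have "next_node L u = Some p" using na P2 by (simp add: next_node_def)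
    moreover have "predecessor (set L) x = Some p"
      using P P2 by (simp add: predecessor_eq_filter[OF assms(2)])
    ultimately show ?thesis by (simp add: advance_def u_def[symmetric])
  qed
qed

lemma search_path_result_from:
  assumes "successively halves (M # Ls)" "\<forall>L\<in>set (M # Ls). sorted_wrt (<) L"
  shows "result (search_path x Ls (predecessor (set M) x)) = map (\<lambda>L. predecessor (set L) x) Ls"
  using assms
proof (induction Ls arbitrary: M)
  case (Cons L Ls)
  then have "result (advance x L (predecessor (set M) x)) = predecessor (set L) x"
    by (intro advance_predecessor) auto
  with Cons show ?case by simp
qed simp

lemma search_path_result:
  assumes "layered S Ls"
  shows "result (search_path x Ls None) = map (\<lambda>L. predecessor (set L) x) Ls"
proof -
  \<comment> \<open>The sentinel where the search starts is the predecessor of \<open>x\<close> in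
    an imaginary empty list on top; by property (1) that list halves the first one.\<close>
  have "halves [] (hd Ls)"
    using assms by (cases "hd Ls" rule: remdups_adj.cases) (auto simp: layered_iff halves_def)
  then have "successively halves ([] # Ls)"
    using assms by (auto simp: layered_iff stacked_def successively_Cons)
  moreover have "predecessor (set []) x = None" by (simp add: predecessor_def)
  ultimately show ?thesis
    using search_path_result_from[of "[]" Ls x] assms by (auto simp: layered_iff stacked_def)
qed

lemma search_path_cost:
  "comparisons (search_path x Ls u) \<le> length Ls" "time (search_path x Ls u) \<le> 2 * length Ls"
proof (induction Ls arbitrary: u)
  case (Cons L Ls)
  have *: "comparisons (advance x L u) \<le> 1" "time (advance x L u) \<le> 2" for u
    by (auto simp: advance_def split: option.split)
  {
    case 1
    show ?case using add_mono[OF *(1) Cons(1)] by simp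
  next
    case 2
    show ?case using add_mono[OF *(2) Cons(2)] by simp
  }
qed simp_all

lemma holds_key_cost: "comparisons (holds_key x u) \<le> 1" "time (holds_key x u) \<le> 1"
  by (auto simp: holds_key_def split: option.split)

lemma holds_key_result:
  assumes "sorted_wrt (<) L"
  shows "result (holds_key x (next_node L (predecessor (set L) x))) \<longleftrightarrow> x \<in> set L"
proof (cases "filter (\<lambda>v. \<not> v < x) L")
  case Nil
  then have "x \<notin> set L" by (auto simp: filter_empty_conv)
  then show ?thesis
    using Nil by (simp add: next_node_def nodes_after_predecessor[OF assms] holds_key_def)
next
  case (Cons v Q)
  have s: "sorted_wrt (<) (v # Q)"
    using sorted_wrt_filter[OF assms, of "\<lambda>v. \<not> v < x"] Cons by simp
  have "set (v # Q) = {v \<in> set L. \<not> v < x}" using Cons by (metis set_filter)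
  then have "x \<in> set L \<longleftrightarrow> x \<in> set (v # Q)" "\<not> v < x" by auto
  then have "x \<in> set L \<longleftrightarrow> \<not> x < v" using s by auto
  then show ?thesis
    using Cons by (simp add: next_node_def nodes_after_predecessor[OF assms] holds_key_def)
qed

section \<open>Splicing at the predecessors found by the search\<close>

lemma splice_in_predecessor:
  assumes "sorted_wrt (<) L" "x \<notin> set L"
  shows "splice_in x (predecessor (set L) x) L = replace x x L"
proof -
  have "next_node L (predecessor (set L) x) \<noteq> Some x"
    using assms(2) by (auto simp: next_node_def nodes_after_predecessor[OF assms(1)]
      dest: filter_eq_ConsD split: list.splits)
  then show ?thesis
    by (simp add: splice_in_def replace_def nodes_after_predecessor[OF assms(1)]
      nodes_upto_predecessor[OF assms(1)] filter_not_less[OF assms(2)])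
qed

lemma splice_out_predecessor:
  assumes "sorted_wrt (<) L"
  shows "splice_out x (predecessor (set L) x) L =
    filter (\<lambda>v. v < x) L @ filter (\<lambda>v. x < v) L"
proof (cases "x \<in> set L")
  case True
  then obtain P Q where L: "L = P @ x # Q" by (meson split_list)
  have P: "\<forall>v\<in>set P. v < x" and Q: "\<forall>v\<in>set Q. x < v"
    using assms L by (auto simp: sorted_wrt_append)
  have "filter (\<lambda>v. \<not> v < x) L = x # Q" "filter (\<lambda>v. x < v) L = Q"
    using P Q L by (auto simp: filter_id_conv filter_empty_conv)
  then show ?thesis
    by (simp add: splice_out_def next_node_def nodes_after_predecessor[OF assms]
      nodes_upto_predecessor[OF assms])
next
  case False
  have "next_node L (predecessor (set L) x) \<noteq> Some x"
    using False by (auto simp: next_node_def nodes_after_predecessor[OF assms]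
      dest: filter_eq_ConsD split: list.splits)
  then show ?thesis
    using filter_less_append[OF assms, of x] by (simp add: splice_out_def filter_not_less[OF False])
qed

text \<open>Removing \<open>x\<close> does not change its predecessor, so the node recorded by the
  search is still the right place. If \<open>y\<close> already follows it, \<open>splice_in\<close>
  does nothing, and \<open>replace\<close> keeps the one copy of \<open>y\<close>.\<close>

lemma splice_in_successor:
  assumes "sorted_wrt (<) L" "x < y" "\<And>v. v \<in> set L \<Longrightarrow> \<not> (x < v \<and> v < y)"
  shows "splice_in y (predecessor (set L) x) (filter (\<lambda>v. v < x) L @ filter (\<lambda>v. x < v) L) =
    replace x y L"
proof -
  define M where "M = filter (\<lambda>v. v < x) L @ filter (\<lambda>v. x < v) L"
  have M: "sorted_wrt (<) M"
    using assms(1) by (force simp: M_def sorted_wrt_append sorted_wrt_filter)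
  have less: "filter (\<lambda>v. v < x) M = filter (\<lambda>v. v < x) L"
    by (auto simp: M_def filter_empty_conv)
  have after: "filter (\<lambda>v. \<not> v < x) M = filter (\<lambda>v. x < v) L"
    by (auto simp: M_def filter_empty_conv intro!: filter_cong)
  have "predecessor (set L) x = predecessor (set M) x"
    by (simp add: predecessor_eq_filter assms(1) M less)
  then have na: "nodes_after M (predecessor (set L) x) = filter (\<lambda>v. x < v) L"
    and nu: "nodes_upto M (predecessor (set L) x) = filter (\<lambda>v. v < x) L"
    by (simp_all add: nodes_after_predecessor[OF M] nodes_upto_predecessor[OF M] less after)
  show ?thesis
  proof (cases "y \<in> set L")
    case True
    then obtain P Q where L: "L = P @ y # Q" by (meson split_list)
    have P: "\<forall>v\<in>set P. \<not> x < v \<and> \<not> y < v"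
      using assms L by (fastforce simp: sorted_wrt_append)
    have Q: "\<forall>v\<in>set Q. y < v" using assms L by (auto simp: sorted_wrt_append)
    have "filter (\<lambda>v. x < v) L = y # Q" "filter (\<lambda>v. y < v) L = Q"
      using P Q L assms(2) by (auto simp: filter_empty_conv filter_id_conv)
    then show ?thesis
      using na unfolding M_def[symmetric] by (simp add: splice_in_def next_node_def replace_def) (simp add: M_def)
  next
    case False
    have "x < v \<longleftrightarrow> y < v" if "v \<in> set L" for v
    proof -
      have "v \<noteq> y" using that False by auto
      then show ?thesis using assms(2) assms(3)[OF that] by auto
    qed
    then have "filter (\<lambda>v. x < v) L = filter (\<lambda>v. y < v) L"
      by (intro filter_cong) auto
    moreover have "next_node M (predecessor (set L) x) \<noteq> Some y"
      using False by (auto simp: next_node_def na dest: filter_eq_ConsD split: list.splits)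
    ultimately show ?thesis
      using na nu unfolding M_def[symmetric] by (simp add: splice_in_def replace_def)
  qed
qed

subsection \<open>Rebuilding\<close>

lemma every_second_simps [simp]:
  "comparisons (every_second L) = 0"
  "time (every_second L) = length L"
  "length (result (every_second L)) = length L div 2"
  by (induction L rule: every_second.induct) simp_all

lemma set_every_second: "set (result (every_second L)) \<subseteq> set L"
  by (induction L rule: every_second.induct) auto

lemma sorted_every_second:
  "sorted_wrt P L \<Longrightarrow> sorted_wrt P (result (every_second L))"
proof (induction L rule: every_second.induct)
  case (3 x y zs)
  then show ?case using set_every_second[of zs] by auto
qed auto

lemma halves_every_second: "halves (result (every_second L)) L"
proof -
  \<comment> \<open>Generalized from the selected set itself to supersets \<open>A\<close>: the
    recursive call selects fewer elements than the whole list does.\<close>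
  have "successively (\<lambda>v w. v \<in> A \<or> w \<in> A) L" if "set (result (every_second L)) \<subseteq> A" for A
    using that
  proof (induction L rule: every_second.induct)
    case (3 x y zs)
    then show ?case by (cases zs) auto
  qed auto
  then show ?thesis using set_every_second[of L] by (simp add: halves_def)
qed

section \<open>Total length under repeated halving\<close>

definition total_length :: "'a list list \<Rightarrow> nat" where
  "total_length Ls = sum_list (map length Ls)"

lemma total_length_simps [simp]:
  "total_length [] = 0"
  "total_length (L # Ls) = length L + total_length Ls"
  "total_length (Ls @ Ms) = total_length Ls + total_length Ms"
  by (simp_all add: total_length_def)

text \<open>The total length of the \<open>i + 1\<close> lists that rebuilding produces from a
  bottom list with \<open>n\<close> nodes.\<close>

primrec halving_sum :: "nat \<Rightarrow> nat \<Rightarrow> nat" where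
  "halving_sum 0 n = n"
| "halving_sum (Suc i) n = n + halving_sum i (n div 2)"

lemma halving_sum_le: "halving_sum i n \<le> 2 * n"
proof (induction i arbitrary: n)
  case (Suc i)
  have "2 * (n div 2) \<le> n" by simp
  with Suc[of "n div 2"] show ?case by simp
qed simp

text \<open>The first summand alone accounts for \<open>n - m\<close>, and halving with rounding is
  monotone, so the other summands do not work against it.\<close>

lemma halving_sum_gain: "m \<le> n \<Longrightarrow> halving_sum i m + (n - m) \<le> halving_sum i n"
proof (induction i arbitrary: m n)
  case (Suc i)
  have "halving_sum i (m div 2) + (n div 2 - m div 2) \<le> halving_sum i (n div 2)"
    using Suc by (simp add: div_le_mono)
  then show ?case using Suc.prems by simp
qed simp

lemma halving_sum_mono: "m \<le> n \<Longrightarrow> halving_sum i m \<le> halving_sum i n"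
  using halving_sum_gain[of m n i] by simp

text \<open>The recursion splits off the longest list. Here the shortest one is split off instead,
  which compares two rebuildings of the same list whose heights differ by one.\<close>

lemma halving_sum_Suc: "halving_sum (Suc i) n = halving_sum i n + n div 2 ^ Suc i"
proof (induction i arbitrary: n)
  case (Suc i)
  have "n div 2 div 2 ^ Suc i = n div 2 ^ Suc (Suc i)"
    by (simp only: power_Suc[of _ "Suc i"] div_mult2_eq)
  with Suc[of "n div 2"] show ?case by simp
qed simp

lemma rebuild_result:
  fixes L :: "'a::linorder list" and i :: nat
  assumes "sorted_wrt (<) L"
  defines "Ms \<equiv> result (rebuild i L)"
  shows "stacked (set L) Ms" "last Ms = L" "length Ms = Suc i"
    "length (hd Ms) = length L div 2 ^ i" "total_length Ms = halving_sum i (length L)"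
proof -
  have "stacked (set L) Ms \<and> last Ms = L \<and> length Ms = Suc i \<and>
    length (hd Ms) = length L div 2 ^ i \<and> total_length Ms = halving_sum i (length L)"
    unfolding Ms_def using assms(1)
  proof (induction i arbitrary: L)
    case 0
    then show ?case by (simp add: stacked_def)
  next
    case (Suc i)
    let ?M = "result (every_second L)" and ?Ms = "result (rebuild i (result (every_second L)))"
    have IH: "stacked (set ?M) ?Ms" "last ?Ms = ?M" "length ?Ms = Suc i"
      "length (hd ?Ms) = length ?M div 2 ^ i" "total_length ?Ms = halving_sum i (length ?M)"
      using Suc.IH[OF sorted_every_second[OF Suc.prems]] by auto
    have ne: "?Ms \<noteq> []" using IH(3) by auto
    have "stacked (set L) (?Ms @ [L])"
      using IH(1,2) Suc.prems halves_every_second[of L]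
      by (auto simp: stacked_def successively_append_iff)
    then show ?case
      using IH ne by (simp add: div_mult2_eq)
  qed
  then show "stacked (set L) Ms" "last Ms = L" "length Ms = Suc i"
    "length (hd Ms) = length L div 2 ^ i" "total_length Ms = halving_sum i (length L)"
    by auto
qed

lemma rebuild_height: "sorted_wrt (<) (L :: 'a::linorder list) \<Longrightarrow> height (result (rebuild i L)) = i"
  by (simp add: height_def rebuild_result)

lemma rebuild_cost:
  "comparisons (rebuild i L) = 0" "time (rebuild i L) \<le> i + 2 * length L"
proof -
  show "comparisons (rebuild i L) = 0" by (induction i arbitrary: L) simp_all
  have "time (rebuild i L) \<le> i + halving_sum i (length L)"
  proof (induction i arbitrary: L)
    case (Suc i)
    show ?case using Suc[of "result (every_second L)"] by simp
  qed simp
  also have "\<dots> \<le> i + 2 * length L" using halving_sum_le by simp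
  finally show "time (rebuild i L) \<le> i + 2 * length L" .
qed

section \<open>Rebuilding the lists above a given level\<close>

lemma stackedE:
  assumes "stacked S Ls" "i \<le> height Ls"
  obtains Us Ds where "Ls = Us @ Ls ! i # Ds" "length Us = i" "drop (i + 1) Ls = Ds"
proof -
  have "i < length Ls" using assms by (auto simp: stacked_def height_def simp flip: length_greater_0_conv)
  then show thesis
    using that[of "take i Ls" "drop (i + 1) Ls"] by (simp add: id_take_nth_drop)
qed

text \<open>By \<open>halves_length\<close> every list has at least half as many nodes, rounded
  down, as the one below. Rebuilding attains this bound on each level, so no stack of the same
  height over the same bottom list is shorter than the rebuilt one.\<close>

lemma halving_sum_le_total_length:
  fixes Ls :: "'a::linorder list list"
  assumes "successively halves Ls" "\<forall>L\<in>set Ls. sorted_wrt (<) L" "length Ls = Suc i"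
  shows "halving_sum i (length (last Ls)) \<le> total_length Ls"
  using assms
proof (induction i arbitrary: Ls)
  case 0
  then show ?case by (cases Ls) auto
next
  case (Suc i)
  obtain Ms L where Ls: "Ls = Ms @ [L]"
    using Suc.prems(3) by (cases Ls rule: rev_cases) auto
  with Suc.prems have "Ms \<noteq> []" "length Ms = Suc i" by auto
  moreover from this have "halves (last Ms) L" "successively halves Ms"
    using Ls Suc.prems(1) by (auto simp: successively_append_iff)
  moreover have "distinct L" using Ls Suc.prems(2) by (simp add: strict_sorted_iff)
  ultimately have "length L div 2 \<le> length (last Ms)"
    "halving_sum i (length (last Ms)) \<le> total_length Ms"
    using Suc Ls by (auto intro: halves_length)
  then show ?case
    using halving_sum_mono[of "length L div 2" "length (last Ms)" i] Ls by simp
qed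

lemma rebuild_bottom_total_length:
  assumes "stacked S Ls"
  shows "halving_sum (height Ls) (card S) \<le> total_length Ls"
  unfolding stacked_card[OF assms]
  using assms by (intro halving_sum_le_total_length) (auto simp: stacked_def length_eq_height)

text \<open>The last claim is the drop that the amortization uses: the list directly above level
  \<open>i\<close> shrinks to half of \<open>Ls ! i\<close>, and by \<open>halving_sum_gain\<close>
  the lists further up do not offset this.\<close>

lemma partial_rebuild_stacked:
  assumes "stacked S Ls" "i \<le> height Ls"
  defines "Ms \<equiv> result (rebuild i (Ls ! i)) @ drop (i + 1) Ls"
  shows "stacked S Ms" "height Ms = height Ls" "length (hd Ms) = length (Ls ! i) div 2 ^ i"
    "total_length Ms \<le> total_length Ls"
    "0 < i \<Longrightarrow> total_length Ms + length (Ls ! (i - 1)) \<le> total_length Ls + length (Ls ! i) div 2"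
proof -
  obtain Us Ds where Ls: "Ls = Us @ Ls ! i # Ds" "length Us = i" "drop (i + 1) Ls = Ds"
    using stackedE[OF assms(1,2)] by metis
  define L where "L = Ls ! i"
  have L: "Ls = Us @ L # Ds" using Ls(1) L_def by simp
  have s: "sorted_wrt (<) L" using assms(1) L by (simp add: stacked_def)
  note r = rebuild_result[OF s, of i]
  have ne: "result (rebuild i L) \<noteq> []" using r(3) by auto
  have Ms: "Ms = result (rebuild i L) @ Ds" using Ls(3) by (simp add: Ms_def L_def)
  have succ: "successively halves (Us @ L # Ds)"
    and sorted: "\<forall>L\<in>set (Us @ L # Ds). sorted_wrt (<) L" and S: "set (last (L # Ds)) = S"
    using assms(1) unfolding L stacked_def by auto
  show "stacked S Ms"
    using r(1,2) ne succ sorted S unfolding Ms stacked_def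
    by (cases Ds) (auto simp: successively_append_iff successively_Cons)
  show "height Ms = height Ls"
    using r(3) Ls(2) by (simp add: Ms height_def) (simp add: L)
  show "length (hd Ms) = length (Ls ! i) div 2 ^ i"
    using r(4) ne by (simp add: Ms L_def)
  have succ': "successively halves (Us @ [L])"
    using succ by (auto simp: successively_append_iff successively_Cons)
  have "halving_sum i (length L) \<le> total_length (Us @ [L])"
    using halving_sum_le_total_length[of "Us @ [L]" i] succ' sorted Ls(2) by auto
  then show "total_length Ms \<le> total_length Ls"
    using r(5) by (simp add: Ms) (simp add: L)
  assume "0 < i"
  then obtain j where j: "i = Suc j" by (cases i) auto
  obtain Vs M where Us: "Us = Vs @ [M]" using Ls(2) j by (cases Us rule: rev_cases) auto
  have M: "Ls ! (i - 1) = M"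
    using L Us Ls(2) j by (simp add: nth_append)
  have "halves M L" using succ' Us by (auto simp: successively_append_iff)
  then have half: "length L div 2 \<le> length M"
    using s by (intro halves_length) (auto simp: strict_sorted_iff)
  have "halving_sum j (length M) \<le> total_length Us"
    using halving_sum_le_total_length[of Us j] succ' sorted Ls(2) j Us
    by (auto simp: successively_append_iff)
  then show "total_length Ms + length (Ls ! (i - 1)) \<le> total_length Ls + length (Ls ! i) div 2"
    using halving_sum_gain[OF half, of j] half r(5) arg_cong[OF L, of total_length]
    unfolding Ms M L_def[symmetric] by (simp add: j)
qed

text \<open>The new top list has \<open>card S div 2 ^ i\<close> nodes, which is at most
  one.\<close>

lemma rebuild_bottom_layered:
  assumes "stacked S Ls" "card S < 2 ^ Suc i"
  shows "layered S (result (rebuild i (last Ls)))"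
proof -
  have "sorted_wrt (<) (last Ls)" "set (last Ls) = S" using assms(1) by (auto simp: stacked_def)
  moreover have "card S div 2 ^ i < 2"
    using assms(2) by (simp add: div_less_iff_less_mult)
  ultimately show ?thesis
    using rebuild_result(1,4)[of "last Ls" i] stacked_card[OF assms(1)] by (simp add: layered_iff)
qed

subsection \<open>Correctness of the updates\<close>

lemma rebuild_level:
  fixes \<epsilon> :: real and Ls :: "'a list list"
  defines "i \<equiv> rebuild_level \<epsilon> Ls"
  shows "i \<le> height Ls" "real (length (Ls ! i)) \<le> (2 - \<epsilon>) ^ i \<or> i = height Ls"
    "j < i \<Longrightarrow> (2 - \<epsilon>) ^ j < real (length (Ls ! j))"
proof -
  let ?P = "\<lambda>i. i \<le> height Ls \<and> real (length (Ls ! i)) \<le> (2 - \<epsilon>) ^ i"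
  have "i \<le> height Ls \<and> (real (length (Ls ! i)) \<le> (2 - \<epsilon>) ^ i \<or> i = height Ls) \<and>
    (\<forall>j<i. \<not> ?P j)"
  proof (cases "\<exists>i. ?P i")
    case True
    then have "i = (LEAST i. ?P i)" by (simp add: i_def rebuild_level_def)
    with LeastI_ex[OF True] not_less_Least[of _ ?P] show ?thesis by auto
  qed (auto simp: i_def rebuild_level_def)
  then show "i \<le> height Ls" "real (length (Ls ! i)) \<le> (2 - \<epsilon>) ^ i \<or> i = height Ls"
    "j < i \<Longrightarrow> (2 - \<epsilon>) ^ j < real (length (Ls ! j))"
    by auto
qed

lemma power_le_two_power: "0 < \<epsilon> \<Longrightarrow> \<epsilon> < 1 \<Longrightarrow> (2 - \<epsilon>) ^ i \<le> (2 :: real) ^ i"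
  by (intro power_mono) auto

text \<open>Halving a list \<open>i\<close> times leaves at most one node if it has at most
  \<open>2 ^ i\<close> nodes. At the chosen level this follows from
  \<open>2 - \<epsilon> < 2\<close>; if no level qualifies and the bottom list is taken, it is the
  bound on \<open>card S\<close>.\<close>

lemma partial_rebuild_correct:
  assumes "stacked S Ls" "length (hd Ls) \<le> 2" "0 < \<epsilon>" "\<epsilon> < 1"
  defines "Ms \<equiv> result (partial_rebuild \<epsilon> Ls)"
  shows "stacked S Ms" "height Ms = height Ls" "total_length Ms \<le> total_length Ls"
    "card S \<le> 2 ^ height Ls \<Longrightarrow> length (hd Ms) \<le> 1"
    "comparisons (partial_rebuild \<epsilon> Ls) = 0"
proof -
  define i where "i = rebuild_level \<epsilon> Ls"
  note i = rebuild_level[where \<epsilon> = \<epsilon> and Ls = Ls, folded i_def]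
  note p = partial_rebuild_stacked[OF assms(1) i(1)]
  have hd: "Ls ! 0 = hd Ls" using assms(1) by (simp add: stacked_def hd_conv_nth)
  have Ms: "Ms = (if length (hd Ls) = 2 then result (rebuild i (Ls ! i)) @ drop (i + 1) Ls else Ls)"
    by (simp add: Ms_def partial_rebuild_def Let_def i_def hd)
  show "stacked S Ms" "height Ms = height Ls" "total_length Ms \<le> total_length Ls"
    using p assms(1) by (simp_all add: Ms)
  show "comparisons (partial_rebuild \<epsilon> Ls) = 0"
    by (simp add: partial_rebuild_def Let_def rebuild_cost)
  assume n: "card S \<le> 2 ^ height Ls"
  have "length (Ls ! i) \<le> 2 ^ i"
    using i(2)
  proof
    assume "real (length (Ls ! i)) \<le> (2 - \<epsilon>) ^ i"
    also have "\<dots> \<le> 2 ^ i" by (rule power_le_two_power) fact+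
    finally show ?thesis by simp
  next
    assume "i = height Ls"
    then show ?thesis
      using n assms(1) stacked_card[OF assms(1)] by (simp add: nth_height stacked_def)
  qed
  then have "length (Ls ! i) div 2 ^ i \<le> 1"
    using div_le_mono[of "length (Ls ! i)" "2 ^ i" "2 ^ i"] by simp
  then show "length (hd Ms) \<le> 1"
    using p(3) assms(2) by (auto simp: Ms)
qed

lemma ceiling_le_two_power:
  fixes \<epsilon> :: real
  assumes "0 < \<epsilon>" "\<epsilon> < 1" shows "\<lceil>(2 - \<epsilon>) ^ i\<rceil> \<le> 2 ^ i"
  using power_le_two_power[OF assms, of i] by (simp add: ceiling_le_iff)

lemma grow_result:
  assumes "stacked S Ls"
  shows "result (grow \<epsilon> Ls) =
    (if int (card S) > \<lceil>(2 - \<epsilon>) ^ height Ls\<rceil> then result (rebuild (height Ls + 1) (last Ls)) else Ls)"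
  using assms stacked_card[OF assms] by (auto simp: grow_def Let_def nth_height stacked_def)

text \<open>Right after an insertion \<open>card S\<close> may exceed \<open>2 ^ height Ls\<close>
  by one, and partial rebuilding may then leave two nodes on top; hence the conditional hypothesis.
  In that case growth is certain to happen, because the threshold is at most
  \<open>2 ^ height Ls\<close>.\<close>

lemma grow_correct:
  assumes "stacked S Ls" "card S \<le> 2 ^ height Ls \<Longrightarrow> length (hd Ls) \<le> 1"
    "card S \<le> 2 ^ height Ls + 1" "0 < \<epsilon>" "\<epsilon> < 1"
  defines "Ms \<equiv> result (grow \<epsilon> Ls)"
  shows "layered S Ms" "card S \<le> 2 ^ height Ms" "comparisons (grow \<epsilon> Ls) = 0"
proof -
  have s: "sorted_wrt (<) (last Ls)" using assms(1) by (auto simp: stacked_def)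
  have Ms: "Ms = (if int (card S) > \<lceil>(2 - \<epsilon>) ^ height Ls\<rceil>
      then result (rebuild (height Ls + 1) (last Ls)) else Ls)"
    by (simp add: Ms_def grow_result[OF assms(1)])
  have "1 \<le> (2::nat) ^ height Ls" by simp
  then have n: "card S \<le> 2 ^ (height Ls + 1)" "card S < 2 ^ Suc (height Ls + 1)"
    using assms(3) unfolding power_Suc Suc_eq_plus1[symmetric] by linarith+
  have "layered S Ms \<and> card S \<le> 2 ^ height Ms"
  proof (cases "int (card S) > \<lceil>(2 - \<epsilon>) ^ height Ls\<rceil>")
    case True
    then show ?thesis
      using rebuild_bottom_layered[OF assms(1) n(2)] n(1) rebuild_height[OF s]
      by (simp add: Ms del: rebuild.simps)
  next
    case False
    then have "int (card S) \<le> 2 ^ height Ls"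
      using ceiling_le_two_power[OF assms(4,5), of "height Ls"] by linarith
    then have "card S \<le> 2 ^ height Ls" by simp
    with False show ?thesis using assms(1,2) by (simp add: Ms layered_iff)
  qed
  then show "layered S Ms" "card S \<le> 2 ^ height Ms" by auto
  show "comparisons (grow \<epsilon> Ls) = 0" by (simp add: grow_def Let_def rebuild_cost)
qed

lemma shrink_result:
  assumes "stacked S Ls"
  shows "result (shrink \<epsilon> Ls) =
    (if height Ls > 0 \<and> int (card S) < \<lceil>(2 - \<epsilon>) powi (int (height Ls) - 2)\<rceil>
     then result (rebuild (height Ls - 1) (last Ls)) else Ls)"
  using assms stacked_card[OF assms] by (auto simp: shrink_def Let_def nth_height stacked_def)

text \<open>Multiplying by the base replaces the integer exponent, which is negative for
  \<open>h = 1\<close>, by a natural number.\<close>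

lemma less_ceiling_powi:
  fixes \<epsilon> :: real
  assumes "0 < \<epsilon>" "\<epsilon> < 1" "h > 0" "int n < \<lceil>(2 - \<epsilon>) powi (int h - 2)\<rceil>"
  shows "real n * (2 - \<epsilon>) < (2 - \<epsilon>) ^ (h - 1)"
proof -
  have "(2 - \<epsilon>) powi (int h - 2) = (2 - \<epsilon>) powi (int (h - 1) - 1)"
    using assms(3) by (intro arg_cong[where f = "power_int _"]) linarith
  also have "\<dots> = (2 - \<epsilon>) ^ (h - 1) / (2 - \<epsilon>)"
    using assms by (subst power_int_diff) (simp_all del: of_nat_diff)
  finally have "real n < (2 - \<epsilon>) ^ (h - 1) / (2 - \<epsilon>)"
    using assms(4) by (simp add: less_ceiling_iff)
  then show ?thesis using assms(1,2) by (simp add: pos_less_divide_eq)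
qed

lemma shrink_correct:
  assumes "layered S Ls" "card S \<le> 2 ^ height Ls" "0 < \<epsilon>" "\<epsilon> < 1"
  defines "Ms \<equiv> result (shrink \<epsilon> Ls)"
  shows "layered S Ms" "card S \<le> 2 ^ height Ms" "comparisons (shrink \<epsilon> Ls) = 0"
proof -
  have st: "stacked S Ls" using assms(1) by (simp add: layered_iff)
  have s: "sorted_wrt (<) (last Ls)" using st by (auto simp: stacked_def)
  have Ms: "Ms = (if height Ls > 0 \<and> int (card S) < \<lceil>(2 - \<epsilon>) powi (int (height Ls) - 2)\<rceil>
     then result (rebuild (height Ls - 1) (last Ls)) else Ls)"
    by (simp add: Ms_def shrink_result[OF st])
  have "layered S Ms \<and> card S \<le> 2 ^ height Ms"
  proof (cases "height Ls > 0 \<and> int (card S) < \<lceil>(2 - \<epsilon>) powi (int (height Ls) - 2)\<rceil>")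
    case True
    have "real (card S) \<le> real (card S) * (2 - \<epsilon>)"
      using assms(4) by (simp add: mult_le_cancel_left1)
    also have "\<dots> < (2 - \<epsilon>) ^ (height Ls - 1)"
      using less_ceiling_powi assms(3,4) True by blast
    also have "\<dots> \<le> 2 ^ (height Ls - 1)" by (rule power_le_two_power) fact+
    finally have n: "card S < 2 ^ (height Ls - 1)" by simp
    moreover from this have "card S < 2 ^ Suc (height Ls - 1)"
      by (rule less_le_trans) simp
    ultimately show ?thesis
      using rebuild_bottom_layered[OF st, of "height Ls - 1"] rebuild_height[OF s] True
      by (simp add: Ms)
  qed (use assms Ms in auto)
  then show "layered S Ms" "card S \<le> 2 ^ height Ms" by auto
  show "comparisons (shrink \<epsilon> Ls) = 0" by (simp add: shrink_def Let_def rebuild_cost)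
qed

lemma sum_lengths:
  assumes "stacked S Ls"
  shows "(\<Sum>i\<le>height Ls. real (length (Ls ! i))) = real (total_length Ls)"
proof -
  have "{0..<length Ls} = {..height Ls}"
    using assms by (auto simp: stacked_def length_eq_height)
  moreover have "total_length Ls = (\<Sum>i\<in>{0..<length Ls}. length (Ls ! i))"
    by (simp add: total_length_def sum_list_sum_nth)
  ultimately show ?thesis by simp
qed

lemma slim_result:
  assumes "stacked S Ls"
  shows "result (slim c Ls) =
    (if real (total_length Ls) > c * real (card S) then result (rebuild (height Ls) (last Ls)) else Ls)"
  using assms stacked_card[OF assms] sum_lengths[OF assms]
  by (auto simp: slim_def Let_def nth_height stacked_def)

lemma slim_correct:
  fixes c :: real
  assumes "layered S Ls" "card S \<le> 2 ^ height Ls"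
  defines "Ms \<equiv> result (slim c Ls)"
  shows "layered S Ms" "height Ms = height Ls" "comparisons (slim c Ls) = 0"
proof -
  have st: "stacked S Ls" using assms(1) by (simp add: layered_iff)
  have s: "sorted_wrt (<) (last Ls)" using st by (auto simp: stacked_def)
  have "card S < 2 ^ Suc (height Ls)"
    using assms(2) by (rule le_less_trans) simp
  then show "layered S Ms" "height Ms = height Ls"
    using rebuild_bottom_layered[OF st] rebuild_height[OF s] assms(1)
    by (auto simp: Ms_def slim_result[OF st])
  show "comparisons (slim c Ls) = 0" by (simp add: slim_def Let_def rebuild_cost)
qed

section \<open>The effect of splicing on all levels\<close>

lemma map2_map_self: "map2 f (map g xs) xs = map (\<lambda>x. f (g x) x) xs"
  by (induction xs) auto

lemma
  assumes "layered S Ls" "x \<notin> S"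
  shows splice_in_all: "map2 (splice_in x) (result (search_path x Ls None)) Ls = map (replace x x) Ls"
    and stacked_splice_in: "stacked (insert x S) (map (replace x x) Ls)"
proof -
  have st: "stacked S Ls" using assms(1) by (simp add: layered_iff)
  \<comment> \<open>As all lists are contained in the bottom one, \<open>x\<close> is missing from
    each of them.\<close>
  have "splice_in x (predecessor (set L) x) L = replace x x L" if "L \<in> set Ls" for L
    using that assms(2) st stacked_subset[of Ls L]
    by (intro splice_in_predecessor) (auto simp: stacked_def)
  then show "map2 (splice_in x) (result (search_path x Ls None)) Ls = map (replace x x) Ls"
    by (simp add: search_path_result[OF assms(1)] map2_map_self)
  have "S = set (last Ls)" using st by (simp add: stacked_def)
  then have "set (replace x x (last Ls)) = insert x S" by (auto simp: replace_def)
  then show "stacked (insert x S) (map (replace x x) Ls)"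
    using stacked_map[OF st, of "replace x x"] by (simp add: halves_replace sorted_replace)
qed

lemma total_length_map:
  assumes "\<And>L. length (f L) \<le> length L + 1"
  shows "total_length (map f Ls) \<le> total_length Ls + length Ls"
proof (induction Ls)
  case (Cons L Ls)
  then show ?case using assms[of L] by simp
qed simp

text \<open>
  Uniformly in the level, deleting \<open>x\<close> replaces everything from \<open>x\<close> to its successor by the
  successor; if there is none, every list is cut off before \<open>x\<close>.
\<close>

lemma splice_out_all:
  assumes "layered S Ls" "x \<in> S"
  defines "us \<equiv> result (search_path x Ls None)"
  defines "Ms \<equiv> map2 (splice_out x) us Ls"
  obtains f where
    "(case next_node (last Ls) (Some x) of None \<Rightarrow> Ms
      | Some y \<Rightarrow> map2 (splice_in y) (butlast us) (butlast Ms) @ [last Ms]) = map f Ls"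
    "stacked (S - {x}) (map f Ls)" "\<And>L. length (f L) \<le> length L + 1"
proof -
  have st: "stacked S Ls" using assms(1) by (simp add: layered_iff)
  have S: "set (last Ls) = S" and ne: "Ls \<noteq> []" and sl: "sorted_wrt (<) (last Ls)"
    using st by (auto simp: stacked_def)
  have sorted: "sorted_wrt (<) L" and sub: "set L \<subseteq> S" if "L \<in> set Ls" for L
    using that st stacked_subset[of Ls L] by (auto simp: stacked_def)
  define g where "g L = filter (\<lambda>v. v < x) L @ filter (\<lambda>v. x < v) L" for L
  have us: "us = map (\<lambda>L. predecessor (set L) x) Ls"
    by (simp add: us_def search_path_result[OF assms(1)])
  have Ms: "Ms = map g Ls"
    using splice_out_predecessor[OF sorted] by (simp add: Ms_def us map2_map_self g_def)
  have after: "nodes_after (last Ls) (Some x) = filter (\<lambda>v. x < v) (last Ls)"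
    using nodes_after_member[OF sl] assms(2) S by simp
  show thesis
  proof (cases "filter (\<lambda>v. x < v) (last Ls)")
    case Nil
    then have le: "\<not> x < v" if "v \<in> S" for v using that S by (auto simp: filter_empty_conv)
    have "g L = filter (\<lambda>v. v < x) L" if "L \<in> set Ls" for L
      using sub[OF that] le by (auto simp: g_def filter_empty_conv)
    then have Ms': "Ms = map (filter (\<lambda>v. v < x)) Ls" by (simp add: Ms)
    have "set (filter (\<lambda>v. v < x) (last Ls)) = S - {x}"
      using le S by (auto simp: not_less order.order_iff_strict)
    then have "stacked (S - {x}) (map (filter (\<lambda>v. v < x)) Ls)"
      using stacked_map[OF st, of "filter (\<lambda>v. v < x)"]
      by (simp add: halves_filter_less sorted_wrt_filter)
    then show ?thesis
      using Nil after by (intro that[of "filter (\<lambda>v. v < x)"])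
        (auto simp: Ms' next_node_def le_SucI)
  next
    case (Cons y Q)
    have sQ: "sorted_wrt (<) (y # Q)" using sorted_wrt_filter[OF sl, of "\<lambda>v. x < v"] Cons by simp
    have setQ: "set (y # Q) = {v \<in> S. x < v}" using Cons S by (metis set_filter)
    then have y: "x < y" "y \<in> S" by auto
    have gap: "\<not> (x < v \<and> v < y)" if "v \<in> S" for v
    proof
      assume v: "x < v \<and> v < y"
      with that setQ have "v \<in> set (y # Q)" by blast
      with sQ v show False by auto
    qed
    have yQ: "filter (\<lambda>v. y < v) (last Ls) = Q"
    proof -
      have "filter (\<lambda>v. y < v) (last Ls) = filter (\<lambda>v. y < v) (y # Q)"
        unfolding Cons[symmetric] filter_filter using y by (intro filter_cong) auto
      also have "\<dots> = Q" using sQ by (auto simp: filter_id_conv)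
      finally show ?thesis .
    qed
    have "map2 (splice_in y) (butlast us) (butlast Ms) = map (replace x y) (butlast Ls)"
    proof -
      have "map2 (splice_in y) (butlast us) (butlast Ms) =
        map (\<lambda>L. splice_in y (predecessor (set L) x) (g L)) (butlast Ls)"
        by (simp add: us Ms map_butlast[symmetric] zip_map_map zip_same_conv_map)
      also have "\<dots> = map (replace x y) (butlast Ls)"
      proof (intro map_cong refl)
        fix L assume "L \<in> set (butlast Ls)"
        then have "L \<in> set Ls" by (rule in_set_butlastD)
        then show "splice_in y (predecessor (set L) x) (g L) = replace x y L"
          unfolding g_def using sorted sub gap y by (intro splice_in_successor) blast+
      qed
      finally show ?thesis .
    qed
    \<comment> \<open>The bottom list does not get \<open>y\<close> spliced in, but it contains
      \<open>y\<close> already, right after \<open>x\<close>; so \<open>replace x y\<close>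
      describes this level as well.\<close>
    moreover have "last Ms = replace x y (last Ls)"
      using ne Cons yQ by (simp add: Ms last_map g_def replace_def)
    ultimately have eq: "map2 (splice_in y) (butlast us) (butlast Ms) @ [last Ms] =
      map (replace x y) Ls"
      using arg_cong[OF append_butlast_last_id[OF ne], of "map (replace x y)"] by simp
    have "v \<in> set (replace x y (last Ls)) \<longleftrightarrow> v \<in> S - {x}" for v
      using gap[of v] y S less_linear[of v x] less_linear[of v y] by (auto simp: replace_def)
    then have "set (replace x y (last Ls)) = S - {x}" by blast
    then have "stacked (S - {x}) (map (replace x y) Ls)"
      using stacked_map[OF st, of "replace x y"] y(1) by (simp add: halves_replace sorted_replace)
    then show ?thesis
      using after Cons eq y(1) by (intro that[of "replace x y"])
        (auto simp: next_node_def intro!: length_replace[unfolded Suc_eq_plus1[symmetric]])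
  qed
qed

section \<open>Insertion and deletion as complete operations\<close>

lemma holds_key_last:
  assumes "layered S Ls"
  shows "result (holds_key x (next_node (last Ls) (last (result (search_path x Ls None))))) \<longleftrightarrow> x \<in> S"
proof -
  have "Ls \<noteq> []" "sorted_wrt (<) (last Ls)" "set (last Ls) = S"
    using assms by (auto simp: layered_iff stacked_def)
  then show ?thesis
    using holds_key_result[of "last Ls" x] by (simp add: search_path_result[OF assms] last_map)
qed

definition key_cost :: "'a::linorder \<Rightarrow> 'a list list \<Rightarrow> nat" where
  "key_cost x Ls = time (search_path x Ls None) +
     time (holds_key x (next_node (last Ls) (last (result (search_path x Ls None)))))"

lemma key_cost_le: "Ls \<noteq> [] \<Longrightarrow> key_cost x Ls \<le> 2 * height Ls + 3"
  unfolding key_cost_def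
  using add_mono[OF search_path_cost(2)[of x Ls None] holds_key_cost(2)[of x "next_node (last Ls) (last (result (search_path x Ls None)))"]]
  by (simp add: length_eq_height)

text \<open>At most one comparison on each of the \<open>height Ls + 1\<close> levels, and one more
  to decide whether \<open>x\<close> is stored. No other phase of an update compares keys.\<close>

lemma key_comparisons_le:
  "Ls \<noteq> [] \<Longrightarrow> comparisons (search_path x Ls None) +
     comparisons (holds_key x (next_node (last Ls) (last (result (search_path x Ls None)))))
   \<le> height Ls + 2"
  using add_mono[OF search_path_cost(1)[of x Ls None] holds_key_cost(1)[of x "next_node (last Ls) (last (result (search_path x Ls None)))"]]
  by (simp add: length_eq_height)

lemma insert_stored:
  assumes "layered S Ls" "x \<in> S"
  shows "result (insert_key \<epsilon> c x Ls) = Ls" "time (insert_key \<epsilon> c x Ls) = key_cost x Ls"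
    "comparisons (insert_key \<epsilon> c x Ls) \<le> height Ls + 2"
  using assms key_comparisons_le[of Ls x]
  by (simp_all add: insert_key_def holds_key_last key_cost_def layered_iff stacked_def)

lemma delete_not_stored:
  assumes "layered S Ls" "x \<notin> S"
  shows "result (delete_key \<epsilon> c x Ls) = Ls" "time (delete_key \<epsilon> c x Ls) = key_cost x Ls"
    "comparisons (delete_key \<epsilon> c x Ls) \<le> height Ls + 2"
  using assms key_comparisons_le[of Ls x]
  by (simp_all add: delete_key_def holds_key_last key_cost_def layered_iff stacked_def)

text \<open>\<open>Ns\<close> are the lists after splicing, before any rebuilding.\<close>

lemma insert_new:
  assumes "layered S Ls" "x \<notin> S"
  obtains Ns Ms Ks where
    "stacked (insert x S) Ns" "height Ns = height Ls" "length (hd Ns) \<le> 2"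
    "total_length Ns \<le> total_length Ls + height Ls + 1"
    "Ms = result (partial_rebuild \<epsilon> Ns)" "Ks = result (grow \<epsilon> Ms)"
    "result (insert_key \<epsilon> c x Ls) = result (slim c Ks)"
    "time (insert_key \<epsilon> c x Ls) = key_cost x Ls + (height Ls + 1) +
       time (partial_rebuild \<epsilon> Ns) + time (grow \<epsilon> Ms) + time (slim c Ks)"
    "comparisons (insert_key \<epsilon> c x Ls) \<le> height Ls + 2 +
       comparisons (partial_rebuild \<epsilon> Ns) + comparisons (grow \<epsilon> Ms) + comparisons (slim c Ks)"
proof -
  let ?Ns = "map (replace x x) Ls"
  have ne: "Ls \<noteq> []" and hd: "length (hd Ls) \<le> 1"
    using assms(1) by (auto simp: layered_iff stacked_def)
  have "stacked (insert x S) ?Ns" by (rule stacked_splice_in[OF assms])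
  moreover have "height ?Ns = height Ls" by (simp add: height_def)
  moreover have "length (hd ?Ns) \<le> 2"
    using ne hd length_replace[of x x "hd Ls"] by (simp add: hd_map)
  moreover have "total_length ?Ns \<le> total_length Ls + height Ls + 1"
    using total_length_map[of "replace x x" Ls] length_replace[of x x] ne
    by (simp add: length_eq_height)
  moreover note key_comparisons_le[OF ne, of x]
  ultimately show thesis
    using holds_key_last[OF assms(1), of x] assms(2) ne
    by (intro that[of ?Ns "result (partial_rebuild \<epsilon> ?Ns)" "result (grow \<epsilon> (result (partial_rebuild \<epsilon> ?Ns)))"])
      (simp_all add: insert_key_def splice_in_all[OF assms] key_cost_def length_eq_height)
qed

lemma delete_stored:
  assumes "layered S Ls" "x \<in> S"
  obtains Ns Ms Ks where
    "stacked (S - {x}) Ns" "height Ns = height Ls" "length (hd Ns) \<le> 2"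
    "total_length Ns \<le> total_length Ls + height Ls + 1"
    "Ms = result (partial_rebuild \<epsilon> Ns)" "Ks = result (shrink \<epsilon> Ms)"
    "result (delete_key \<epsilon> c x Ls) = result (slim c Ks)"
    "time (delete_key \<epsilon> c x Ls) = key_cost x Ls + 2 * (height Ls + 1) +
       time (partial_rebuild \<epsilon> Ns) + time (shrink \<epsilon> Ms) + time (slim c Ks)"
    "comparisons (delete_key \<epsilon> c x Ls) \<le> height Ls + 2 +
       comparisons (partial_rebuild \<epsilon> Ns) + comparisons (shrink \<epsilon> Ms) + comparisons (slim c Ks)"
proof -
  have ne: "Ls \<noteq> []" and hd: "length (hd Ls) \<le> 1"
    using assms(1) by (auto simp: layered_iff stacked_def)
  obtain f where f: "(case next_node (last Ls) (Some x) of
        None \<Rightarrow> map2 (splice_out x) (result (search_path x Ls None)) Ls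
      | Some y \<Rightarrow> map2 (splice_in y) (butlast (result (search_path x Ls None)))
          (butlast (map2 (splice_out x) (result (search_path x Ls None)) Ls)) @
          [last (map2 (splice_out x) (result (search_path x Ls None)) Ls)]) = map f Ls"
    "stacked (S - {x}) (map f Ls)" "\<And>L. length (f L) \<le> length L + 1"
    by (rule splice_out_all[OF assms]) blast
  let ?Ns = "map f Ls"
  have "height ?Ns = height Ls" by (simp add: height_def)
  moreover have "length (hd ?Ns) \<le> 2"
    using ne hd f(3)[of "hd Ls"] by (simp add: hd_map)
  moreover have "total_length ?Ns \<le> total_length Ls + height Ls + 1"
    using total_length_map[of f Ls] f(3) ne by (simp add: length_eq_height)
  moreover note key_comparisons_le[OF ne, of x]
  ultimately show thesis
    using holds_key_last[OF assms(1), of x] assms(2) ne f(2)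
    by (intro that[of ?Ns "result (partial_rebuild \<epsilon> ?Ns)" "result (shrink \<epsilon> (result (partial_rebuild \<epsilon> ?Ns)))"])
      (simp_all add: delete_key_def f(1) key_cost_def length_eq_height)
qed

lemma insert_new_correct:
  assumes "layered S Ls" "x \<notin> S" "card S \<le> 2 ^ height Ls" "0 < \<epsilon>" "\<epsilon> < 1"
  shows "layered (insert x S) (result (insert_key \<epsilon> c x Ls))"
    "comparisons (insert_key \<epsilon> c x Ls) \<le> height Ls + 2"
proof -
  obtain Ns Ms Ks where *: "stacked (insert x S) Ns" "height Ns = height Ls" "length (hd Ns) \<le> 2"
    "Ms = result (partial_rebuild \<epsilon> Ns)" "Ks = result (grow \<epsilon> Ms)"
    "result (insert_key \<epsilon> c x Ls) = result (slim c Ks)"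
    "comparisons (insert_key \<epsilon> c x Ls) \<le> height Ls + 2 +
       comparisons (partial_rebuild \<epsilon> Ns) + comparisons (grow \<epsilon> Ms) + comparisons (slim c Ks)"
    by (rule insert_new[OF assms(1,2), of \<epsilon> c]) blast
  have n: "card (insert x S) \<le> 2 ^ height Ls + 1"
  proof -
    have "finite S" using assms(1) by (auto simp: layered_def)
    then show ?thesis using assms(2,3) by simp
  qed
  note p = partial_rebuild_correct[OF *(1,3) assms(4,5), folded *(4), unfolded *(2)]
  have g: "layered (insert x S) Ks" "card (insert x S) \<le> 2 ^ height Ks" "comparisons (grow \<epsilon> Ms) = 0"
    using grow_correct[OF p(1) _ _ assms(4,5), folded *(5)] p(2,4) n by auto
  note s = slim_correct[OF g(1,2), of c]
  show "layered (insert x S) (result (insert_key \<epsilon> c x Ls))"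
    "comparisons (insert_key \<epsilon> c x Ls) \<le> height Ls + 2"
    using * p g s by simp_all
qed

lemma delete_stored_correct:
  assumes "layered S Ls" "x \<in> S" "card S \<le> 2 ^ height Ls" "0 < \<epsilon>" "\<epsilon> < 1"
  shows "layered (S - {x}) (result (delete_key \<epsilon> c x Ls))"
    "comparisons (delete_key \<epsilon> c x Ls) \<le> height Ls + 2"
proof -
  obtain Ns Ms Ks where *: "stacked (S - {x}) Ns" "height Ns = height Ls" "length (hd Ns) \<le> 2"
    "Ms = result (partial_rebuild \<epsilon> Ns)" "Ks = result (shrink \<epsilon> Ms)"
    "result (delete_key \<epsilon> c x Ls) = result (slim c Ks)"
    "comparisons (delete_key \<epsilon> c x Ls) \<le> height Ls + 2 +
       comparisons (partial_rebuild \<epsilon> Ns) + comparisons (shrink \<epsilon> Ms) + comparisons (slim c Ks)"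
    by (rule delete_stored[OF assms(1,2), of \<epsilon> c]) blast
  have n: "card (S - {x}) \<le> 2 ^ height Ls"
    using card_Diff1_le[of S x] assms(3) by (rule order.trans)
  note p = partial_rebuild_correct[OF *(1,3) assms(4,5), folded *(4), unfolded *(2)]
  have "layered (S - {x}) Ms" using p n by (simp add: layered_iff)
  then have g: "layered (S - {x}) Ks" "card (S - {x}) \<le> 2 ^ height Ks" "comparisons (shrink \<epsilon> Ms) = 0"
    using shrink_correct[of "S - {x}" Ms \<epsilon>, folded *(5)] assms(4,5) p(2) n by auto
  note s = slim_correct[OF g(1,2), of c]
  show "layered (S - {x}) (result (delete_key \<epsilon> c x Ls))"
    "comparisons (delete_key \<epsilon> c x Ls) \<le> height Ls + 2"
    using * p g s by simp_all
qed

lemma search_correct: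
  assumes "layered S Ls"
  shows "result (search x Ls) = predecessor S x" "comparisons (search x Ls) \<le> height Ls + 2"
proof -
  have ne: "Ls \<noteq> []" "set (last Ls) = S" using assms by (auto simp: layered_iff stacked_def)
  then show "result (search x Ls) = predecessor S x"
    by (simp add: search_def search_path_result[OF assms] last_map)
  show "comparisons (search x Ls) \<le> height Ls + 2"
    using search_path_cost(1)[of x Ls None] ne by (simp add: search_def length_eq_height)
qed

lemma supports_within:
  assumes "layered S Ls" "card S \<le> 2 ^ height Ls" "0 < \<epsilon>" "\<epsilon> < 1" "real (height Ls) + 2 \<le> B"
  shows "supports_within \<epsilon> c B S Ls"
proof -
  have B: "real k \<le> B" if "k \<le> height Ls + 2" for k
    using that assms(5) by linarith
  have "layered (insert x S) (result (insert_key \<epsilon> c x Ls)) \<and>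
    comparisons (insert_key \<epsilon> c x Ls) \<le> height Ls + 2" for x
    using insert_stored[OF assms(1), of x \<epsilon> c] insert_new_correct[OF assms(1) _ assms(2-4), of x c] assms(1)
    by (cases "x \<in> S") (auto simp: insert_absorb)
  moreover have "layered (S - {x}) (result (delete_key \<epsilon> c x Ls)) \<and>
    comparisons (delete_key \<epsilon> c x Ls) \<le> height Ls + 2" for x
    using delete_not_stored[OF assms(1), of x \<epsilon> c] delete_stored_correct[OF assms(1) _ assms(2-4), of x c] assms(1)
    by (cases "x \<in> S") auto
  ultimately show ?thesis
    unfolding supports_within_def using B search_correct[OF assms(1)] by blast
qed

lemma todolist_card:
  assumes "todolist \<epsilon> S Ls" "0 < \<epsilon>" "\<epsilon> < 1"
  shows "card S \<le> 2 ^ height Ls"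
proof (cases "card S = 0")
  case False
  have "log (2 - \<epsilon>) (card S) \<le> real (height Ls)"
    using assms(1) by (simp add: todolist_def ceiling_le_iff)
  then have "real (card S) \<le> (2 - \<epsilon>) powr real (height Ls)"
    using False assms by (simp add: log_le_iff)
  also have "\<dots> = (2 - \<epsilon>) ^ height Ls" using assms by (simp add: powr_realpow)
  also have "\<dots> \<le> 2 ^ height Ls" by (rule power_le_two_power) fact+
  finally show ?thesis by simp
qed simp

text \<open>Of the constant 4, one is for the ceiling, one for the slack in the height, and two come
  from the bound \<open>height Ls + 2\<close> on the comparisons.\<close>

lemma todolist_supports:
  assumes "todolist \<epsilon> S Ls" "0 < \<epsilon>" "\<epsilon> < 1"
  shows "supports_within \<epsilon> c (log (2 - \<epsilon>) (real (card S)) + 4) S Ls"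
proof (rule supports_within[OF _ todolist_card[OF assms] assms(2,3)])
  show "layered S Ls" using assms(1) by (simp add: todolist_def)
  have "real (height Ls) \<le> real_of_int \<lceil>log (2 - \<epsilon>) (card S)\<rceil> + 1"
    using assms(1) unfolding todolist_def by linarith
  then show "real (height Ls) + 2 \<le> log (2 - \<epsilon>) (card S) + 4" by linarith
qed

subsection \<open>Amortized running time\<close>

lemma stacked_sorted_last: "stacked S Ls \<Longrightarrow> sorted_wrt (<) (last Ls)"
  by (auto simp: stacked_def)

text \<open>Level 0 is kept apart because no list above it could shrink and pay for a summand
  \<open>length (Ls ! i)\<close>.\<close>

lemma partial_rebuild_time:
  fixes \<epsilon> :: real
  assumes "stacked S Ls" "length (hd Ls) = 2"
  defines "i \<equiv> rebuild_level \<epsilon> Ls"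
  shows "time (partial_rebuild \<epsilon> Ls) \<le> (if i = 0 then 2 else 2 * height Ls + 2 + 2 * length (Ls ! i))"
proof -
  have "time (partial_rebuild \<epsilon> Ls) = i + 2 + time (rebuild i (Ls ! i))"
    using assms by (simp add: partial_rebuild_def Let_def i_def stacked_def hd_conv_nth)
  moreover have "i \<le> height Ls" unfolding i_def by (rule rebuild_level)
  ultimately show ?thesis using rebuild_cost(2)[of i "Ls ! i"] by simp
qed

text \<open>The bound \<open>\<epsilon>\<^sub>0\<close> keeps the base away from 1, so that
  \<open>M\<close>, \<alpha>, \<open>A\<close> and \<open>D\<close> can be chosen independently of
  \<epsilon>. The number \<open>M\<close> makes \<open>b ^ M\<close> at least 2 and at least
  \<open>1 / (b - 1)\<close>; it bounds, up to 2, how far the height may be off.\<close>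

locale todolist_parameters =
  fixes \<epsilon> \<epsilon>\<^sub>0 c :: real and M :: nat
  assumes eps: "0 < \<epsilon>" "\<epsilon> \<le> \<epsilon>\<^sub>0" "\<epsilon>\<^sub>0 < 1" and c: "c > 2"
    and M: "2 / (1 - \<epsilon>\<^sub>0) \<le> (2 - \<epsilon>\<^sub>0) ^ M"
begin

abbreviation b :: real where "b \<equiv> 2 - \<epsilon>"

text \<open>The 8 pays for partial rebuilding. The other summand pays for slimming, which costs
  about \<open>2 * n\<close> steps and shortens the lists by at least
  \<open>(c - 2) * n\<close>.\<close>

definition \<alpha> :: real where "\<alpha> = 8 + 2 / (c - 2)"
text \<open>Chosen so that \<open>A * (b - 1)\<close> is at least 4. Changing the height by one
  moves the reference point \<open>b ^ h / b\<close> by a factor \<open>b\<close>, and the potential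
  thus released has to pay about \<open>2 * n\<close> steps.\<close>

definition A :: real where "A = 4 / (1 - \<epsilon>\<^sub>0)"

text \<open>
  The first summand pays for partial rebuilding and for slimming, the second for the changes of
  height: these happen when \<open>n\<close> is far from \<open>b\<^bsup>h-1\<^esup>\<close>, and close to it for the new \<open>h\<close>.
\<close>

definition potential :: "'a list list \<Rightarrow> real" where
  "potential Ls = \<alpha> / \<epsilon> * total_length Ls + A * \<bar>real (length (last Ls)) - b ^ height Ls / b\<bar>"

text \<open>The second alternative is the lag of the height for few values and \<open>b\<close> close to \<open>1\<close>.\<close>

definition fits :: "nat \<Rightarrow> nat \<Rightarrow> bool" where
  "fits n h \<longleftrightarrow> int n \<le> \<lceil>b ^ h\<rceil> \<or> n \<le> h + 1"

text \<open>The lower bound on \<open>n\<close> mirrors the threshold for shrinking. At small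
  heights consecutive powers of \<open>b\<close> may differ by less than one, so giving up one level
  per deletion need not restore the bound; there a constant bound on the height takes its
  place.\<close>

definition balanced :: "nat \<Rightarrow> nat \<Rightarrow> bool" where
  "balanced n h \<longleftrightarrow> fits n h \<and> (h \<le> M + 2 \<or> b ^ (h - 2) \<le> real n)"

section \<open>Inequalities between the constants\<close>

lemma eps_less_1: "\<epsilon> < 1" using eps by simp

lemma base_bounds: "1 < b" "b < 2" "0 < b" using eps by auto

lemma alpha_bounds: "8 \<le> \<alpha>" "2 \<le> \<alpha> * (c - 2)" "\<alpha> \<le> \<alpha> / \<epsilon>" "8 / \<epsilon> \<le> \<alpha> / \<epsilon>"
proof -
  show a: "8 \<le> \<alpha>" using c by (simp add: \<alpha>_def)
  have "c - 2 \<noteq> 0" using c by simp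
  then have "2 = 2 / (c - 2) * (c - 2)" by (simp only: times_divide_eq_left nonzero_mult_div_cancel_right not_False_eq_True)
  also have "\<dots> \<le> \<alpha> * (c - 2)" using c by (intro mult_right_mono) (auto simp: \<alpha>_def)
  finally show "2 \<le> \<alpha> * (c - 2)" .
  show "\<alpha> \<le> \<alpha> / \<epsilon>" using a eps eps_less_1 by (simp add: le_divide_eq mult_le_cancel_left2)
  show "8 / \<epsilon> \<le> \<alpha> / \<epsilon>" using a eps by (intro divide_right_mono) auto
qed

lemma A_bounds: "0 \<le> A" "4 \<le> A * (b - 1)"
proof -
  show a: "0 \<le> A" using eps by (simp add: A_def)
  have "1 - \<epsilon>\<^sub>0 \<noteq> 0" using eps by simp
  then have "4 = A * (1 - \<epsilon>\<^sub>0)"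
    by (simp only: A_def times_divide_eq_left nonzero_mult_div_cancel_right not_False_eq_True)
  also have "\<dots> \<le> A * (b - 1)" using eps a by (intro mult_left_mono) auto
  finally show "4 \<le> A * (b - 1)" .
qed

lemma power_M: "2 \<le> b ^ M" "1 \<le> b ^ M * (b - 1)"
proof -
  have "2 / (1 - \<epsilon>\<^sub>0) \<le> b ^ M"
    using M by (rule order.trans) (use eps in \<open>intro power_mono; simp\<close>)
  moreover have "2 \<le> 2 / (1 - \<epsilon>\<^sub>0)" using eps by (simp add: le_divide_eq)
  ultimately show "2 \<le> b ^ M" by linarith
  have "1 \<le> 2 / (1 - \<epsilon>\<^sub>0) * (1 - \<epsilon>\<^sub>0)" using eps by simp
  also have "\<dots> \<le> b ^ M * (b - 1)"
    using eps \<open>2 / (1 - \<epsilon>\<^sub>0) \<le> b ^ M\<close> by (intro mult_mono) auto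
  finally show "1 \<le> b ^ M * (b - 1)" .
qed

section \<open>Keeping the height close to the logarithm\<close>

lemma fits_real: "fits n h \<Longrightarrow> real n \<le> b ^ h + 1 \<or> n \<le> h + 1"
  unfolding fits_def by linarith

lemma fits_two_power:
  assumes "fits n h" shows "n \<le> 2 ^ h"
  using assms unfolding fits_def
proof
  assume "int n \<le> \<lceil>b ^ h\<rceil>"
  then have "int n \<le> 2 ^ h" using ceiling_le_two_power[OF eps(1) eps_less_1, of h] by linarith
  then show ?thesis by simp
next
  assume "n \<le> h + 1"
  then show ?thesis using less_exp[of h] by linarith
qed

text \<open>The gaps between consecutive powers increase. As long as they are below one, the power
  grows by less than one per level, starting from 1, and stays at most \<open>h + 1\<close>; once
  they reach one they remain at least one.\<close>

lemma power_growth: "b ^ h \<le> real h + 1 \<or> b ^ h + 1 \<le> b ^ Suc h"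
proof (induction h)
  case (Suc h)
  have "b * 1 \<le> b * (b ^ Suc h - b ^ h)" if "b ^ h + 1 \<le> b ^ Suc h"
    using that base_bounds by (intro mult_left_mono) auto
  then have "b ^ h + 1 \<le> b ^ Suc h \<Longrightarrow> b ^ Suc h + 1 \<le> b ^ Suc (Suc h)"
    using base_bounds by (auto simp: algebra_simps)
  then show ?case using Suc by fastforce
qed simp

text \<open>If \<open>m\<close> exceeds \<open>h + 1\<close>, then so does \<open>b ^ h\<close>, and
  the gap to the next power is at least one. The additional level therefore makes room for the
  additional value.\<close>

lemma fits_grow:
  assumes "fits m h" "int (Suc m) > \<lceil>b ^ h\<rceil>"
  shows "fits (Suc m) (h + 1)"
proof (cases "m \<le> h + 1")
  case False
  then have m: "int m \<le> \<lceil>b ^ h\<rceil>" using assms(1) by (simp add: fits_def)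
  then have "real h + 1 < b ^ h" using False by linarith
  then have "b ^ h + 1 \<le> b ^ Suc h" using power_growth[of h] by simp
  then have "\<lceil>b ^ h\<rceil> + 1 \<le> \<lceil>b ^ Suc h\<rceil>"
    using ceiling_mono[of "b ^ h + 1" "b ^ Suc h"] by simp
  with m show ?thesis by (simp add: fits_def)
qed (simp add: fits_def)

lemma balanced_grow:
  assumes "balanced m h"
  shows "balanced (Suc m) (if int (Suc m) > \<lceil>b ^ h\<rceil> then h + 1 else h)"
proof (cases "int (Suc m) > \<lceil>b ^ h\<rceil>")
  case True
  have "b ^ (h + 1 - 2) \<le> b ^ h" using base_bounds by (intro power_increasing) auto
  also have "\<dots> \<le> real (Suc m)" using True by linarith
  finally show ?thesis
    using True assms fits_grow[of m h] by (simp add: balanced_def)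
qed (use assms in \<open>auto simp: balanced_def fits_def\<close>)

lemma balanced_shrink:
  assumes "balanced (Suc m) h"
  shows "balanced m (if h > 0 \<and> int m < \<lceil>b powi (int h - 2)\<rceil> then h - 1 else h)"
proof (cases "h > 0 \<and> int m < \<lceil>b powi (int h - 2)\<rceil>")
  case True
  have "real m * 1 \<le> real m * b" using base_bounds by (intro mult_left_mono) auto
  also have "real m * b < b ^ (h - 1)"
    using less_ceiling_powi eps(1) eps_less_1 True by blast
  finally have "int m \<le> \<lceil>b ^ (h - 1)\<rceil>" by linarith
  moreover have "h - 1 \<le> M + 2 \<or> b ^ (h - 1 - 2) \<le> real m"
  proof (cases "h - 1 \<le> M + 2")
    case False
    then have "\<not> h \<le> M + 2" by linarith
    then have "b ^ (h - 2) \<le> real (Suc m)" using assms unfolding balanced_def by blast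
    moreover have "b ^ (h - 2) = b * b ^ (h - 3)"
      using False by (simp add: Suc_diff_Suc numeral_3_eq_3 numeral_2_eq_2 flip: power_Suc)
    \<comment> \<open>At this height the level given up lowers the bound by at least one, which
      makes up for the deleted value.\<close>
    moreover have "1 \<le> b ^ (h - 3) * (b - 1)"
    proof (rule order.trans[OF power_M(2)])
      show "b ^ M * (b - 1) \<le> b ^ (h - 3) * (b - 1)"
        using False base_bounds by (intro mult_right_mono power_increasing) auto
    qed
    moreover have "b ^ (h - 1 - 2) = b ^ (h - 3)" by (simp add: numeral_3_eq_3 numeral_2_eq_2)
    ultimately show ?thesis by (simp add: algebra_simps del: diff_diff_left)
  qed simp
  ultimately show ?thesis using True by (simp add: balanced_def fits_def)
next
  case False
  have "b ^ (h - 2) \<le> real m" if "h > 2"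
  proof -
    have "\<lceil>b powi (int h - 2)\<rceil> \<le> int m" using False that by auto
    moreover have "int h - 2 = int (h - 2)" using that by simp
    ultimately have "\<lceil>b ^ (h - 2)\<rceil> \<le> int m" by (simp del: of_nat_diff)
    then show ?thesis by linarith
  qed
  moreover have "fits m h" using assms by (auto simp: balanced_def fits_def)
  ultimately show ?thesis using False by (cases "h > 2") (auto simp: balanced_def)
qed

text \<open>For \<open>log b n \<le> h + M\<close>, the factor \<open>b ^ M\<close> absorbs the
  rounding since it is at least 2, and absorbs the lag since Bernoulli's inequality gives
  \<open>(h + 1) * (b - 1) \<le> b ^ h\<close>. The other direction is the lower bound in
  \<open>balanced\<close>. For \<open>n = 0\<close> the logarithm is 0 by convention, and
  \<open>balanced\<close> forces a small height.\<close>

lemma balanced_height: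
  assumes "balanced n h"
  shows "\<bar>real h - log b (real n)\<bar> \<le> real M + 2"
proof (cases "n = 0")
  case True
  have "h \<le> M + 2"
  proof (rule ccontr)
    assume "\<not> h \<le> M + 2"
    then have "b ^ (h - 2) \<le> 0" using assms True by (simp add: balanced_def)
    moreover have "0 < b ^ (h - 2)" using base_bounds by simp
    ultimately show False by simp
  qed
  then show ?thesis using True by (simp add: log_def)
next
  case False
  then have n: "1 \<le> real n" by simp
  have "real n \<le> b ^ (h + M)"
  proof -
    have "1 \<le> b ^ h" using base_bounds by (simp add: one_le_power)
    have "real n \<le> b ^ h + 1 \<or> n \<le> h + 1"
      using fits_real[of n h] assms by (simp add: balanced_def)
    then have "real n \<le> b ^ h * b ^ M"
    proof
      assume "real n \<le> b ^ h + 1"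
      also have "\<dots> \<le> b ^ h * 2" using \<open>1 \<le> b ^ h\<close> by simp
      also have "\<dots> \<le> b ^ h * b ^ M" using power_M(1) base_bounds by (intro mult_left_mono) auto
      finally show ?thesis .
    next
      assume "n \<le> h + 1"
      have "real h * (b - 1) + 1 \<le> b ^ h"
        using Bernoulli_inequality[of "b - 1" h] base_bounds by simp
      then have "(real h + 1) * (b - 1) \<le> b ^ h" using base_bounds by (simp add: algebra_simps)
      then have "b ^ M * ((real h + 1) * (b - 1)) \<le> b ^ M * b ^ h"
        using base_bounds by (intro mult_left_mono) auto
      moreover have "(real h + 1) * 1 \<le> (real h + 1) * (b ^ M * (b - 1))"
        using power_M(2) by (intro mult_left_mono) auto
      ultimately show ?thesis using \<open>n \<le> h + 1\<close> by (simp add: algebra_simps)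
    qed
    then show ?thesis by (simp add: power_add)
  qed
  then have "log b n \<le> real (h + M)"
    using n base_bounds powr_realpow[of b "h + M"] by (subst log_le_iff) auto
  moreover have "real h \<le> log b n + M + 2"
  proof (cases "h \<le> M + 2")
    case True
    moreover have "0 \<le> log b n" using n base_bounds by simp
    ultimately show ?thesis by linarith
  next
    case False
    then have "b ^ (h - 2) \<le> real n" using assms by (simp add: balanced_def)
    then have "real (h - 2) \<le> log b n"
      using n base_bounds by (simp add: le_log_iff powr_realpow)
    then show ?thesis by linarith
  qed
  ultimately show ?thesis by linarith
qed

section \<open>Amortized cost of the phases of an update\<close>

lemma partial_rebuild_amortized:
  assumes "stacked S Ls" "length (hd Ls) \<le> 2"
    and n: "real (card S) \<le> b ^ height Ls + 2 \<or> card S \<le> height Ls + 2"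
  shows "time (partial_rebuild \<epsilon> Ls) + potential (result (partial_rebuild \<epsilon> Ls))
    \<le> potential Ls + (4 * height Ls + 6) + \<alpha> / \<epsilon>"
proof -
  define q where "q = \<alpha> / \<epsilon>"
  let ?Ms = "result (partial_rebuild \<epsilon> Ls)" and ?h = "height Ls"
  define D where "D = real (total_length Ls) - real (total_length ?Ms)"
  note p = partial_rebuild_correct[OF assms(1,2) eps(1) eps_less_1]
  have D: "0 \<le> D" using p(3) by (simp add: D_def)
  have "potential Ls - potential ?Ms = \<alpha> / \<epsilon> * D"
    using p(2) stacked_card[OF assms(1)] stacked_card[OF p(1)]
    by (simp add: potential_def D_def algebra_simps)
  \<comment> \<open>Up to one unit, the drop \<open>D\<close> of the total length pays for the
    rebuilt nodes at the rate \<open>8 / \<epsilon>\<close>; the missing unit is the summand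
    \<open>\<alpha> / \<epsilon>\<close> of the claim.\<close>
  moreover have "real (time (partial_rebuild \<epsilon> Ls)) \<le> 4 * ?h + 6 + 8 / \<epsilon> * (D + 1)"
  proof (cases "length (hd Ls) = 2")
    case True
    define i where "i = rebuild_level \<epsilon> Ls"
    note i = rebuild_level[where \<epsilon> = \<epsilon> and Ls = Ls, folded i_def]
    note t = partial_rebuild_time[OF assms(1) True, of \<epsilon>, folded i_def]
    have pos: "0 \<le> 8 / \<epsilon> * (D + 1)" using D eps by simp
    show ?thesis
    proof (cases "i = 0")
      case False
      then have t': "real (time (partial_rebuild \<epsilon> Ls)) \<le> 2 * ?h + 2 + 2 * real (length (Ls ! i))"
        using t by simp
      have "?Ms = result (rebuild i (Ls ! i)) @ drop (i + 1) Ls"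
        using True assms(1) by (simp add: partial_rebuild_def Let_def i_def stacked_def hd_conv_nth)
      then have "total_length ?Ms + length (Ls ! (i - 1)) \<le> total_length Ls + length (Ls ! i) div 2"
        using partial_rebuild_stacked(5)[OF assms(1) i(1)] False by simp
      then have "real (length (Ls ! (i - 1))) \<le> D + real (length (Ls ! i) div 2)"
        unfolding D_def by linarith
      also have "\<dots> \<le> D + real (length (Ls ! i)) / 2" by linarith
      \<comment> \<open>By minimality of \<open>i\<close>, the list above level \<open>i\<close> had
        more than \<open>b ^ (i - 1)\<close> nodes before it was cut down.\<close>
      finally have D': "b ^ (i - 1) \<le> D + real (length (Ls ! i)) / 2"
        using i(3)[of "i - 1"] False by linarith
      \<comment> \<open>The slack 2 and the second alternative are for the case that no level
        qualifies and \<open>i\<close> is the bottom, where only the bound on \<open>card S\<close>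
        is known.\<close>
      have "real (length (Ls ! i)) \<le> b ^ i + 2 \<or> length (Ls ! i) \<le> ?h + 2"
        using i(2) n assms(1) stacked_card[OF assms(1)] by (auto simp: nth_height stacked_def)
      then show ?thesis
      proof
        assume L: "real (length (Ls ! i)) \<le> b ^ i + 2"
        have bi: "b ^ i = b * b ^ (i - 1)" using False by (simp flip: power_Suc)
        \<comment> \<open>The identity behind this is
          \<open>b ^ (i - 1) - b ^ i / 2 = \<epsilon> / 2 * b ^ (i - 1)\<close>; the summand 1 next
          to \<open>D\<close> is half of the slack 2.\<close>
        have "\<epsilon> / 2 * b ^ (i - 1) \<le> D + 1" using D' L bi by (simp add: field_simps)
        then have "8 / \<epsilon> * (\<epsilon> / 2 * b ^ (i - 1)) \<le> 8 / \<epsilon> * (D + 1)"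
          using eps by (intro mult_left_mono) auto
        then have "4 * b ^ (i - 1) \<le> 8 / \<epsilon> * (D + 1)" using eps by simp
        moreover have "2 * b ^ i \<le> 4 * b ^ (i - 1)" using base_bounds bi by simp
        ultimately show ?thesis using t' L by linarith
      qed (use t' pos in linarith)
    qed (use t pos in simp)
  next
    case False
    then have "time (partial_rebuild \<epsilon> Ls) = 1"
      using assms(1) by (simp add: partial_rebuild_def stacked_def hd_conv_nth)
    moreover have "0 \<le> 8 / \<epsilon> * (D + 1)" using D eps by simp
    ultimately show ?thesis by simp
  qed
  moreover have "8 / \<epsilon> * (D + 1) \<le> \<alpha> / \<epsilon> * (D + 1)"
    using alpha_bounds(4) D by (intro mult_right_mono) auto
  ultimately show ?thesis unfolding q_def[symmetric] by (simp add: distrib_left)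
qed

lemma grow_amortized:
  assumes "stacked S Ls" and n: "card S = Suc m" "fits m (height Ls)"
  shows "time (grow \<epsilon> Ls) + potential (result (grow \<epsilon> Ls))
    \<le> potential Ls + (3 * height Ls + 6) + \<alpha> / \<epsilon>"
proof (cases "int (card S) > \<lceil>b ^ height Ls\<rceil>")
  case True
  let ?h = "height Ls" and ?n = "real (card S)"
  let ?Ms = "result (rebuild (?h + 1) (last Ls))"
  note r = rebuild_result[OF stacked_sorted_last[OF assms(1)], of "?h + 1"]
  have len: "length (last Ls) = card S" by (simp add: stacked_card[OF assms(1)])
  have res: "result (grow \<epsilon> Ls) = ?Ms" using True by (simp add: grow_result[OF assms(1)])
  have "time (grow \<epsilon> Ls) = 1 + time (rebuild (?h + 1) (last Ls))"
    using True assms(1) len by (simp add: grow_def Let_def nth_height stacked_def)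
  then have "time (grow \<epsilon> Ls) \<le> ?h + 2 + 2 * card S"
    using rebuild_cost(2)[of "?h + 1" "last Ls"] len by simp
  then have t: "real (time (grow \<epsilon> Ls)) \<le> ?h + 2 + 2 * ?n" by linarith
  have "card S \<le> 2 ^ ?h + 1" using fits_two_power[OF n(2)] n(1) by simp
  also have "\<dots> \<le> 2 ^ (?h + 1)" by simp
  finally have "card S div 2 ^ (?h + 1) \<le> 1"
    using div_le_mono[of "card S" "2 ^ (?h + 1)" "2 ^ (?h + 1)"] by simp
  then have "total_length ?Ms \<le> total_length Ls + 1"
    \<comment> \<open>The taller rebuilt stack differs from the rebuilt stack of the old height only
      in its new top list, which has at most one node.\<close>
    using r(5) rebuild_bottom_total_length[OF assms(1)] halving_sum_Suc[of ?h "card S"] len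
    by (simp del: rebuild.simps halving_sum.simps)
  then have "\<alpha> / \<epsilon> * total_length ?Ms \<le> \<alpha> / \<epsilon> * (real (total_length Ls) + 1)"
    using alpha_bounds(1) eps by (intro mult_left_mono) auto
  \<comment> \<open>Since \<open>n > b ^ h\<close>, raising the reference point from
    \<open>b ^ h / b\<close> to \<open>b ^ h\<close> releases
    \<open>A * (b - 1) * (b ^ h / b)\<close>. This is at least \<open>4 * b ^ h / b\<close>, hence
    at least \<open>2 * b ^ h\<close> as \<open>b < 2\<close>; the rest of \<open>2 * n\<close> is
    covered by \<open>2 * h + 4\<close>.\<close>
  moreover have "A * \<bar>?n - b ^ ?h\<bar> + 2 * ?n \<le> A * \<bar>?n - b ^ ?h / b\<bar> + 2 * ?h + 4"
  proof -
    have le: "b ^ ?h / b \<le> b ^ ?h" using base_bounds by (simp add: divide_le_eq)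
    have gt: "b ^ ?h < ?n" using True by linarith
    have "A * \<bar>?n - b ^ ?h / b\<bar> - A * \<bar>?n - b ^ ?h\<bar> = A * (b ^ ?h - b ^ ?h / b)"
      using le gt by (simp add: algebra_simps)
    also have "\<dots> = A * (b - 1) * (b ^ ?h / b)"
      using base_bounds by (simp add: field_simps)
    finally have eq: "A * \<bar>?n - b ^ ?h / b\<bar> - A * \<bar>?n - b ^ ?h\<bar> = A * (b - 1) * (b ^ ?h / b)" .
    have "4 * (b ^ ?h / b) \<le> A * (b - 1) * (b ^ ?h / b)"
      using A_bounds base_bounds by (intro mult_right_mono) auto
    moreover have "2 * b ^ ?h \<le> 4 * (b ^ ?h / b)" using base_bounds by (simp add: field_simps)
    moreover have "0 \<le> 4 * (b ^ ?h / b)" using base_bounds by simp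
    moreover have "?n \<le> b ^ ?h + 2 \<or> ?n \<le> ?h + 2"
      using fits_real[OF n(2)] n(1) by auto
    ultimately show ?thesis using eq by linarith
  qed
  moreover have "potential ?Ms = \<alpha> / \<epsilon> * total_length ?Ms + A * \<bar>?n - b ^ ?h\<bar>"
    using base_bounds r(2) rebuild_height[OF stacked_sorted_last[OF assms(1)], of "?h + 1"] len
    by (simp add: potential_def del: rebuild.simps)
  moreover have "potential Ls = \<alpha> / \<epsilon> * total_length Ls + A * \<bar>?n - b ^ ?h / b\<bar>"
    by (simp add: potential_def len)
  ultimately show ?thesis using t unfolding res by (simp add: algebra_simps)
next
  case False
  then have "result (grow \<epsilon> Ls) = Ls" "time (grow \<epsilon> Ls) = 1"
    using assms(1) stacked_card[OF assms(1)]
    by (simp_all add: grow_def Let_def nth_height stacked_def)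
  then show ?thesis using alpha_bounds by simp
qed

lemma shrink_amortized:
  assumes "stacked S Ls"
  shows "time (shrink \<epsilon> Ls) + potential (result (shrink \<epsilon> Ls)) \<le> potential Ls + height Ls + 1"
proof (cases "height Ls > 0 \<and> int (card S) < \<lceil>b powi (int (height Ls) - 2)\<rceil>")
  case True
  let ?h = "height Ls" and ?n = "real (card S)"
  let ?Ms = "result (rebuild (?h - 1) (last Ls))" and ?P = "b ^ (?h - 1)"
  note r = rebuild_result[OF stacked_sorted_last[OF assms(1)], of "?h - 1"]
  have len: "length (last Ls) = card S" by (simp add: stacked_card[OF assms(1)])
  have res: "result (shrink \<epsilon> Ls) = ?Ms" using True by (simp add: shrink_result[OF assms(1)])
  have "time (shrink \<epsilon> Ls) = 1 + time (rebuild (?h - 1) (last Ls))"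
    using True assms(1) len by (simp add: shrink_def Let_def nth_height stacked_def)
  then have "time (shrink \<epsilon> Ls) \<le> ?h + 2 * card S"
    using rebuild_cost(2)[of "?h - 1" "last Ls"] len True by linarith
  then have t: "real (time (shrink \<epsilon> Ls)) \<le> ?h + 2 * ?n" by linarith
  have "halving_sum (?h - 1) (card S) \<le> halving_sum ?h (card S)"
    using halving_sum_Suc[of "?h - 1" "card S"] True by simp
  then have "total_length ?Ms \<le> total_length Ls"
    using r(5) rebuild_bottom_total_length[OF assms(1)] len by simp
  then have "\<alpha> / \<epsilon> * total_length ?Ms \<le> \<alpha> / \<epsilon> * total_length Ls"
    using alpha_bounds(1) eps by (intro mult_left_mono) auto
  \<comment> \<open>The mirror image of growing: \<open>n\<close> is below both reference points,
    and lowering \<open>?P\<close> to \<open>?P / b\<close> releases at least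
    \<open>4 * (?P / b)\<close>, which exceeds \<open>2 * n\<close>.\<close>
  moreover have "A * \<bar>?n - ?P / b\<bar> + 2 * ?n \<le> A * \<bar>?n - ?P\<bar>"
  proof -
    have le: "?P / b \<le> ?P" using base_bounds by (simp add: divide_le_eq)
    have "?n * b < ?P" using less_ceiling_powi eps(1) eps_less_1 True by blast
    then have lt: "?n < ?P / b" using base_bounds by (simp add: pos_less_divide_eq)
    have "A * \<bar>?n - ?P\<bar> - A * \<bar>?n - ?P / b\<bar> = A * (?P - ?P / b)"
      using le lt by (simp add: algebra_simps)
    also have "\<dots> = A * (b - 1) * (?P / b)"
      using base_bounds by (simp add: field_simps)
    finally have eq: "A * \<bar>?n - ?P\<bar> - A * \<bar>?n - ?P / b\<bar> = A * (b - 1) * (?P / b)" .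
    have "4 * (?P / b) \<le> A * (b - 1) * (?P / b)"
      using A_bounds base_bounds by (intro mult_right_mono) auto
    then show ?thesis using eq lt by linarith
  qed
  moreover have "potential ?Ms = \<alpha> / \<epsilon> * total_length ?Ms + A * \<bar>?n - ?P / b\<bar>"
    using r(2) rebuild_height[OF stacked_sorted_last[OF assms(1)], of "?h - 1"] len
    by (simp add: potential_def)
  moreover have "potential Ls = \<alpha> / \<epsilon> * total_length Ls + A * \<bar>?n - ?P\<bar>"
    using base_bounds True by (simp add: potential_def len power_diff)
  ultimately show ?thesis using t unfolding res by linarith
next
  case False
  then have "result (shrink \<epsilon> Ls) = Ls" "time (shrink \<epsilon> Ls) = 1"
    using assms(1) stacked_card[OF assms(1)]
    by (auto simp: shrink_def Let_def nth_height stacked_def)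
  then show ?thesis by simp
qed

text \<open>Rebuilding leaves at most \<open>2 * n\<close> nodes out of more than
  \<open>c * n\<close>. By the choice of \<alpha> this drop pays for the \<open>2 * n\<close> steps;
  the second summand of the potential stays the same, as \<open>n\<close> and the height do.\<close>

lemma slim_amortized:
  assumes "stacked S Ls"
  shows "time (slim c Ls) + potential (result (slim c Ls)) \<le> potential Ls + height Ls + 1"
proof (cases "real (total_length Ls) > c * real (card S)")
  case True
  let ?h = "height Ls" and ?Ms = "result (rebuild (height Ls) (last Ls))"
  note r = rebuild_result[OF stacked_sorted_last[OF assms(1)], of ?h]
  have len: "length (last Ls) = card S" by (simp add: stacked_card[OF assms(1)])
  have res: "result (slim c Ls) = ?Ms" using True by (simp add: slim_result[OF assms(1)])
  have "time (slim c Ls) \<le> 1 + time (rebuild ?h (last Ls))"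
    using assms(1) by (simp add: slim_def Let_def nth_height stacked_def)
  then have "time (slim c Ls) \<le> 1 + ?h + 2 * card S"
    using rebuild_cost(2)[of ?h "last Ls"] len by simp
  then have t: "real (time (slim c Ls)) \<le> 1 + ?h + 2 * real (card S)" by linarith
  have "real (total_length ?Ms) \<le> 2 * real (card S)"
    using r(5) halving_sum_le[of ?h "card S"] len by simp
  then have "(c - 2) * card S \<le> real (total_length Ls) - total_length ?Ms"
    using True by (simp add: algebra_simps)
  then have "\<alpha> / \<epsilon> * ((c - 2) * card S) \<le> \<alpha> / \<epsilon> * (real (total_length Ls) - total_length ?Ms)"
    using alpha_bounds(1) eps by (intro mult_left_mono) auto
  moreover have "\<alpha> * ((c - 2) * card S) \<le> \<alpha> / \<epsilon> * ((c - 2) * card S)"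
    using alpha_bounds(3) c by (intro mult_right_mono) auto
  moreover have "2 * real (card S) \<le> \<alpha> * (c - 2) * real (card S)"
    using alpha_bounds(2) by (intro mult_right_mono) auto
  moreover have "potential Ls - potential ?Ms = \<alpha> / \<epsilon> * (real (total_length Ls) - total_length ?Ms)"
    using r(2) rebuild_height[OF stacked_sorted_last[OF assms(1)], of ?h]
    by (simp add: potential_def algebra_simps)
  ultimately show ?thesis using t unfolding res by (simp add: mult.assoc)
next
  case False
  then have "result (slim c Ls) = Ls" by (simp add: slim_result[OF assms(1)])
  moreover have "time (slim c Ls) = 1"
    using False assms(1) stacked_card[OF assms(1)] sum_lengths[OF assms(1)]
    by (simp add: slim_def Let_def nth_height stacked_def)
  ultimately show ?thesis by simp
qed

section \<open>Amortized cost of a whole update\<close>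

lemma potential_splice:
  assumes "height Ns = height Ls" "total_length Ns \<le> total_length Ls + height Ls + 1"
    "\<bar>real (length (last Ns)) - real (length (last Ls))\<bar> \<le> 1"
  shows "potential Ns \<le> potential Ls + \<alpha> / \<epsilon> * (height Ls + 1) + A"
proof -
  have "\<alpha> / \<epsilon> * total_length Ns \<le> \<alpha> / \<epsilon> * (real (total_length Ls) + (height Ls + 1))"
    using alpha_bounds(1) eps assms(2) by (intro mult_left_mono) auto
  moreover have "A * \<bar>real (length (last Ns)) - b ^ height Ls / b\<bar> \<le>
    A * (\<bar>real (length (last Ls)) - b ^ height Ls / b\<bar> + 1)"
    using A_bounds(1) assms(3) by (intro mult_left_mono) auto
  ultimately show ?thesis using assms(1) by (simp add: potential_def algebra_simps)
qed

definition D :: real where "D = 22 + 3 * \<alpha> + A"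

text \<open>As \<open>\<epsilon> < 1\<close>, the terms without the factor
  \<open>1 / \<epsilon>\<close> may be given one. Then \<open>D\<close> collects the coefficients,
  using \<open>h + 3 \<le> 3 * (h + 1)\<close>.\<close>

lemma amortized_bound:
  assumes "t \<le> 11 * real h + 22 + \<alpha> / \<epsilon> * (real h + 3) + A"
  shows "t \<le> D * (real h + 1) / \<epsilon>"
proof -
  have "1 * (11 * real h + 22 + A) \<le> 1 / \<epsilon> * (11 * real h + 22 + A)"
    using eps eps_less_1 A_bounds by (intro mult_right_mono) (auto simp: le_divide_eq)
  also have "\<dots> + \<alpha> / \<epsilon> * (real h + 3) = 1 / \<epsilon> * (11 * real h + 22 + A + \<alpha> * (real h + 3))"
    by (simp add: algebra_simps add_divide_distrib)
  also have "\<dots> \<le> 1 / \<epsilon> * (D * (real h + 1))"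
  proof (intro mult_left_mono)
    have "0 \<le> A * h" "0 \<le> \<alpha> * h" using A_bounds alpha_bounds by auto
    then show "11 * real h + 22 + A + \<alpha> * (real h + 3) \<le> D * (real h + 1)"
      by (simp add: D_def algebra_simps)
  qed (use eps in simp)
  finally show ?thesis using assms by simp
qed

lemma insert_amortized:
  assumes "layered S Ls" "x \<notin> S" "balanced (card S) (height Ls)"
  defines "R \<equiv> insert_key \<epsilon> c x Ls"
  shows "balanced (card (insert x S)) (height (result R))"
    "time R + potential (result R) \<le> potential Ls + D * (real (height Ls) + 1) / \<epsilon>"
proof -
  define q where "q = \<alpha> / \<epsilon>"
  let ?h = "height Ls" and ?S = "insert x S"
  have st: "stacked S Ls" using assms(1) by (simp add: layered_iff)
  have n: "card ?S = Suc (card S)" using assms(1,2) by (auto simp: layered_def)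
  have fits: "fits (card S) ?h" using assms(3) by (simp add: balanced_def)
  obtain Ns Ms Ks where *: "stacked ?S Ns" "height Ns = ?h" "length (hd Ns) \<le> 2"
    "total_length Ns \<le> total_length Ls + ?h + 1"
    "Ms = result (partial_rebuild \<epsilon> Ns)" "Ks = result (grow \<epsilon> Ms)"
    "result R = result (slim c Ks)"
    "time R = key_cost x Ls + (?h + 1) +
       time (partial_rebuild \<epsilon> Ns) + time (grow \<epsilon> Ms) + time (slim c Ks)"
    unfolding R_def by (rule insert_new[OF assms(1,2), of \<epsilon> c]) blast
  note p = partial_rebuild_correct[OF *(1,3) eps(1) eps_less_1, folded *(5), unfolded *(2)]
  have two: "card ?S \<le> 2 ^ ?h + 1" using fits_two_power[OF fits] n by simp
  have g: "layered ?S Ks" "card ?S \<le> 2 ^ height Ks"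
    using grow_correct[OF p(1) _ _ eps(1) eps_less_1, folded *(6)] p(2,4) two by auto
  have Ks: "height Ks = (if int (card ?S) > \<lceil>b ^ ?h\<rceil> then ?h + 1 else ?h)"
    using grow_result[OF p(1), of \<epsilon>] p(2) rebuild_height[OF stacked_sorted_last[OF p(1)]]
    by (simp add: *(6) del: rebuild.simps)
  note s = slim_correct[OF g, of c]
  show "balanced (card ?S) (height (result R))"
    using balanced_grow[OF assms(3)] s(2) by (simp add: *(7) Ks n)
  have "\<bar>real (length (last Ns)) - real (length (last Ls))\<bar> \<le> 1"
    using stacked_card[OF *(1)] stacked_card[OF st] n by simp
  note 0 = potential_splice[OF *(2,4) this]
  have "real (card ?S) \<le> b ^ ?h + 2 \<or> card ?S \<le> ?h + 2"
    using fits_real[OF fits] n by auto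
  note 1 = partial_rebuild_amortized[OF *(1,3), unfolded *(2), OF this, folded *(5)]
  note 2 = grow_amortized[OF p(1) n, unfolded p(2), OF fits, folded *(6)]
  have "stacked ?S Ks" using g(1) by (simp add: layered_iff)
  note 3 = slim_amortized[OF this, folded *(7)]
  have "real (height Ks) \<le> ?h + 1" by (simp add: Ks)
  moreover have "real (key_cost x Ls) \<le> 2 * ?h + 3"
    using key_cost_le[of Ls x] st unfolding stacked_def by linarith
  \<comment> \<open>The \<open>h + 3\<close> units of \<open>\<alpha> / \<epsilon>\<close> are
    \<open>h + 1\<close> for the spliced nodes, one for partial rebuilding and one for the new top
    list when the height grows.\<close>
  ultimately have "real (time R) + potential (result R) - potential Ls
      \<le> 11 * real ?h + 22 + \<alpha> / \<epsilon> * (real ?h + 3) + A"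
    using 0 1 2 3 unfolding *(8) q_def[symmetric] by (simp add: algebra_simps)
  from amortized_bound[OF this]
  show "time R + potential (result R) \<le> potential Ls + D * (real ?h + 1) / \<epsilon>"
    by linarith
qed

lemma delete_amortized:
  assumes "layered S Ls" "x \<in> S" "balanced (card S) (height Ls)"
  defines "R \<equiv> delete_key \<epsilon> c x Ls"
  shows "balanced (card (S - {x})) (height (result R))"
    "time R + potential (result R) \<le> potential Ls + D * (real (height Ls) + 1) / \<epsilon>"
proof -
  define q where "q = \<alpha> / \<epsilon>"
  let ?h = "height Ls" and ?S = "S - {x}"
  have st: "stacked S Ls" using assms(1) by (simp add: layered_iff)
  have "finite S" using assms(1) by (auto simp: layered_def)
  then have n: "card S = Suc (card ?S)" using card_Suc_Diff1[of S x] assms(2) by simp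
  have fits: "fits (card S) ?h" using assms(3) by (simp add: balanced_def)
  obtain Ns Ms Ks where *: "stacked ?S Ns" "height Ns = ?h" "length (hd Ns) \<le> 2"
    "total_length Ns \<le> total_length Ls + ?h + 1"
    "Ms = result (partial_rebuild \<epsilon> Ns)" "Ks = result (shrink \<epsilon> Ms)"
    "result R = result (slim c Ks)"
    "time R = key_cost x Ls + 2 * (?h + 1) +
       time (partial_rebuild \<epsilon> Ns) + time (shrink \<epsilon> Ms) + time (slim c Ks)"
    unfolding R_def by (rule delete_stored[OF assms(1,2), of \<epsilon> c]) blast
  note p = partial_rebuild_correct[OF *(1,3) eps(1) eps_less_1, folded *(5), unfolded *(2)]
  have two: "card ?S \<le> 2 ^ ?h" using fits_two_power[OF fits] n by simp
  have "layered ?S Ms" using p two by (simp add: layered_iff)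
  then have g: "layered ?S Ks" "card ?S \<le> 2 ^ height Ks"
    using shrink_correct[of ?S Ms \<epsilon>, folded *(6)] eps(1) eps_less_1 p(2) two by auto
  have Ks: "height Ks = (if ?h > 0 \<and> int (card ?S) < \<lceil>b powi (int ?h - 2)\<rceil> then ?h - 1 else ?h)"
    using shrink_result[OF p(1), of \<epsilon>] p(2) rebuild_height[OF stacked_sorted_last[OF p(1)]]
    by (simp add: *(6))
  note s = slim_correct[OF g, of c]
  show "balanced (card ?S) (height (result R))"
    using balanced_shrink[OF assms(3)[unfolded n]] s(2) by (simp add: *(7) Ks)
  have "\<bar>real (length (last Ns)) - real (length (last Ls))\<bar> \<le> 1"
    using stacked_card[OF *(1)] stacked_card[OF st] n by simp
  note 0 = potential_splice[OF *(2,4) this]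
  have "real (card ?S) \<le> b ^ ?h + 2 \<or> card ?S \<le> ?h + 2"
    using fits_real[OF fits] n by auto
  note 1 = partial_rebuild_amortized[OF *(1,3), unfolded *(2), OF this, folded *(5)]
  note 2 = shrink_amortized[OF p(1), unfolded p(2), folded *(6)]
  have "stacked ?S Ks" using g(1) by (simp add: layered_iff)
  note 3 = slim_amortized[OF this, folded *(7)]
  have "real (height Ks) \<le> ?h" by (simp add: Ks)
  moreover have "real (key_cost x Ls) \<le> 2 * ?h + 3"
    using key_cost_le[of Ls x] st unfolding stacked_def by linarith
  moreover have "0 \<le> \<alpha> / \<epsilon>" using alpha_bounds by simp
  ultimately have "real (time R) + potential (result R) - potential Ls
      \<le> 11 * real ?h + 22 + \<alpha> / \<epsilon> * (real ?h + 3) + A"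
    using 0 1 2 3 unfolding *(8) q_def[symmetric] by (simp add: algebra_simps)
  from amortized_bound[OF this]
  show "time R + potential (result R) \<le> potential Ls + D * (real ?h + 1) / \<epsilon>"
    by linarith
qed

lemma perform_amortized:
  fixes p :: "'a::linorder op"
  assumes "layered S Ls" "balanced (card S) (height Ls)"
  defines "R \<equiv> perform \<epsilon> c p Ls" and "S' \<equiv> update_values p S"
  shows "layered S' (result R)" "balanced (card S') (height (result R))"
    "time R + potential (result R) \<le> potential Ls + D * (real (height Ls) + 1) / \<epsilon>"
proof -
  have fits: "card S \<le> 2 ^ height Ls" using fits_two_power assms(2) by (simp add: balanced_def)
  have key: "real (key_cost x Ls) \<le> D * (real (height Ls) + 1) / \<epsilon>" for x
  proof (rule amortized_bound)
    have "Ls \<noteq> []" using assms(1) by (auto simp: layered_iff stacked_def)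
    then have "real (key_cost x Ls) \<le> 11 * real (height Ls) + 22"
      using key_cost_le[of Ls x] by linarith
    moreover have "0 \<le> \<alpha> / \<epsilon> * (real (height Ls) + 3)" using alpha_bounds eps by simp
    ultimately show "real (key_cost x Ls) \<le>
        11 * real (height Ls) + 22 + \<alpha> / \<epsilon> * (real (height Ls) + 3) + A"
      using A_bounds(1) by linarith
  qed
  have "layered S' (result R) \<and> balanced (card S') (height (result R)) \<and>
    time R + potential (result R) \<le> potential Ls + D * (real (height Ls) + 1) / \<epsilon>"
  proof (cases p)
    case (Insert x)
    show ?thesis
    proof (cases "x \<in> S")
      case True
      then show ?thesis
        using Insert insert_stored[OF assms(1), of x \<epsilon> c] key[of x] assms(1,2)
        by (simp add: R_def S'_def insert_absorb)
    next
      case False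
      then show ?thesis
        using Insert insert_amortized[OF assms(1) False assms(2)]
          insert_new_correct(1)[OF assms(1) False fits eps(1) eps_less_1]
        by (simp add: R_def S'_def)
    qed
  next
    case (Delete x)
    show ?thesis
    proof (cases "x \<in> S")
      case False
      then show ?thesis
        using Delete delete_not_stored[OF assms(1), of x \<epsilon> c] key[of x] assms(1,2)
        by (simp add: R_def S'_def)
    next
      case True
      then show ?thesis
        using Delete delete_amortized[OF assms(1) True assms(2)]
          delete_stored_correct(1)[OF assms(1) True fits eps(1) eps_less_1]
        by (simp add: R_def S'_def)
    qed
  qed
  then show "layered S' (result R)" "balanced (card S') (height (result R))"
    "time R + potential (result R) \<le> potential Ls + D * (real (height Ls) + 1) / \<epsilon>"
    by auto
qed

section \<open>Sequences of updates\<close>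

lemma card_update_values: "finite S \<Longrightarrow> card (update_values p S) \<le> Suc (card S)"
  by (cases p) (auto simp: card_insert_if card_Diff1_le le_SucI)

lemma potential_nonneg: "0 \<le> potential Ls"
  using alpha_bounds A_bounds eps by (simp add: potential_def)

lemma D_nonneg: "0 \<le> D"
  using alpha_bounds A_bounds by (simp add: D_def)

text \<open>Passing to the smallest base allowed, \<open>2 - \<epsilon>\<^sub>0\<close>, makes the
  bound independent of \<epsilon>.\<close>

lemma height_le:
  fixes N :: nat
  assumes "balanced n h" "n \<le> N" "0 < N"
  shows "real h + 1 \<le> ln N / ln (2 - \<epsilon>\<^sub>0) + M + 3"
proof -
  have "log b n \<le> ln N / ln (2 - \<epsilon>\<^sub>0)"
  proof (cases "n = 0")
    case True
    then show ?thesis using assms eps by (simp add: log_def)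
  next
    case False
    have "log b n \<le> ln N / ln b"
      using False assms base_bounds by (simp add: log_def divide_right_mono)
    also have "\<dots> \<le> ln N / ln (2 - \<epsilon>\<^sub>0)"
      using assms eps by (intro divide_left_mono) auto
    finally show ?thesis .
  qed
  then show ?thesis using balanced_height[OF assms(1)] by linarith
qed

text \<open>An update adds at most one value, so \<open>card S + length ps \<le> N\<close> persists
  while \<open>ps\<close> is used up. Thus \<open>N\<close> bounds every intermediate size, each
  update gets the same charge, and the potentials telescope.\<close>

lemma perform_all_amortized:
  fixes N :: nat
  assumes "layered S Ls" "balanced (card S) (height Ls)" "card S + length ps \<le> N" "0 < N"
  defines "R \<equiv> perform_all \<epsilon> c ps Ls" and "S' \<equiv> fold update_values ps S"
  shows "layered S' (result R) \<and> balanced (card S') (height (result R)) \<and>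
    time R \<le> potential Ls + length ps * (D * (ln N / ln (2 - \<epsilon>\<^sub>0) + M + 3) / \<epsilon>)"
  using assms(1-3) unfolding R_def S'_def
proof (induction ps arbitrary: S Ls)
  case Nil
  then show ?case using potential_nonneg by simp
next
  case (Cons p ps)
  let ?R = "perform \<epsilon> c p Ls" and ?B = "D * (ln N / ln (2 - \<epsilon>\<^sub>0) + M + 3) / \<epsilon>"
  note p = perform_amortized[OF Cons.prems(1,2), of p]
  have "finite S" using Cons.prems(1) by (auto simp: layered_def)
  then have "card (update_values p S) + length ps \<le> N"
    using card_update_values[of S p] Cons.prems(3) by simp
  note IH = Cons.IH[OF p(1,2) this]
  have "D * (real (height Ls) + 1) / \<epsilon> \<le> ?B"
    using height_le[OF Cons.prems(2) _ assms(4)] Cons.prems(3) D_nonneg eps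
    by (intro divide_right_mono mult_left_mono) auto
  then have "time ?R + potential (result ?R) \<le> potential Ls + ?B" using p(3) by linarith
  then show ?case using IH by (simp add: distrib_right add_divide_distrib)
qed

lemma perform_all_empty:
  fixes ps :: "'a::linorder op list"
  defines "R \<equiv> perform_all \<epsilon> c ps empty_todolist" and "S \<equiv> values_after ps" and "N \<equiv> length ps"
  shows "layered S (result R)" "balanced (card S) (height (result R))"
    "2 \<le> N \<Longrightarrow> time R \<le>
      (2 * A + D * (1 / ln (2 - \<epsilon>\<^sub>0) + 2 * (M + 3))) * (1 / \<epsilon>) * N * ln N"
proof -
  have "layered {} (empty_todolist :: 'a list list)"
    by (simp add: layered_def empty_todolist_def height_def)
  moreover have "balanced (card ({} :: 'a set)) (height (empty_todolist :: 'a list list))"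
    by (simp add: balanced_def fits_def empty_todolist_def height_def)
  \<comment> \<open>The maximum with 1 keeps the bound on the sizes positive for the empty
    sequence.\<close>
  ultimately have *: "layered S (result R) \<and> balanced (card S) (height (result R)) \<and>
    time R \<le> potential (empty_todolist :: 'a list list) +
      N * (D * (ln (real (max 1 N)) / ln (2 - \<epsilon>\<^sub>0) + M + 3) / \<epsilon>)"
    using perform_all_amortized[of "{}" empty_todolist ps "max 1 N"]
    by (simp add: R_def S_def N_def values_after_def)
  then show "layered S (result R)" "balanced (card S) (height (result R))" by auto
  assume N: "2 \<le> N"
  \<comment> \<open>For \<open>N \<ge> 2\<close> this turns the additive constants and the initial
    potential into multiples of \<open>ln N\<close>.\<close>
  have "1 / 2 \<le> ln (2::real)" using ln2_ge_two_thirds by simp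
  also have "\<dots> \<le> ln N" using N by simp
  finally have ln: "1 \<le> 2 * ln N" by simp
  have "potential (empty_todolist :: 'a list list) \<le> A * 1"
    unfolding potential_def empty_todolist_def height_def
    using A_bounds(1) base_bounds mult_left_mono[of 1 b A] by (simp add: divide_le_eq)
  also have "\<dots> \<le> A * (1 / \<epsilon> * N * (2 * ln N))"
  proof (intro mult_left_mono A_bounds)
    have "1 * 1 * 1 \<le> 1 / \<epsilon> * N * (2 * ln N)"
      using eps eps_less_1 N ln by (intro mult_mono) (auto simp: le_divide_eq)
    then show "1 \<le> 1 / \<epsilon> * N * (2 * ln N)" by simp
  qed
  finally have 1: "potential (empty_todolist :: 'a list list) \<le> 2 * A * (1 / \<epsilon>) * N * ln N"
    by (simp add: mult_ac)
  have "N * (D * (ln N / ln (2 - \<epsilon>\<^sub>0) + M + 3) / \<epsilon>) =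
    D * (1 / \<epsilon>) * N * (ln N / ln (2 - \<epsilon>\<^sub>0) + (M + 3) * 1)"
    by simp
  also have "\<dots> \<le> D * (1 / \<epsilon>) * N * (ln N / ln (2 - \<epsilon>\<^sub>0) + (M + 3) * (2 * ln N))"
    using ln D_nonneg eps by (intro mult_left_mono add_left_mono) auto
  also have "\<dots> = D * (1 / ln (2 - \<epsilon>\<^sub>0) + 2 * (M + 3)) * (1 / \<epsilon>) * N * ln N"
    by (simp add: algebra_simps)
  finally have "time R \<le> 2 * A * (1 / \<epsilon>) * N * ln N +
      D * (1 / ln (2 - \<epsilon>\<^sub>0) + 2 * (M + 3)) * (1 / \<epsilon>) * N * ln N"
    using * 1 N by (simp add: max_def)
  also have "\<dots> = (2 * A + D * (1 / ln (2 - \<epsilon>\<^sub>0) + 2 * (M + 3))) * (1 / \<epsilon>) * N * ln N"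
    by (simp add: distrib_right add_divide_distrib)
  finally show "time R \<le>
      (2 * A + D * (1 / ln (2 - \<epsilon>\<^sub>0) + 2 * (M + 3))) * (1 / \<epsilon>) * N * ln N" .
qed

end

theorem theorem1:
  shows
    "(\<exists>K::real. \<forall>\<epsilon>\<in>{0<..<1}. \<forall>c>2. \<forall>(S::'a::linorder set) Ls.
        todolist \<epsilon> S Ls \<longrightarrow>
        supports_within \<epsilon> c (log (2 - \<epsilon>) (real (card S)) + K) S Ls)
     \<and>
     (\<forall>c>2. \<forall>\<epsilon>\<^sub>0\<in>{0<..<1}. \<exists>K C::real. \<forall>\<epsilon>\<in>{0<..\<epsilon>\<^sub>0}. \<forall>ps::'a op list.
        let R = perform_all \<epsilon> c ps empty_todolist; Ls = result R;
            S = values_after ps; l = log (2 - \<epsilon>) (real (card S)); N = length ps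
        in layered S Ls
           \<and> \<bar>real (height Ls) - l\<bar> \<le> K
           \<and> supports_within \<epsilon> c (l + K) S Ls
           \<and> (N \<ge> 2 \<longrightarrow> real (time R) \<le> C * (1 / \<epsilon>) * real N * ln (real N)))"
proof (intro conjI allI impI ballI)
  show "\<exists>K::real. \<forall>\<epsilon>\<in>{0<..<1}. \<forall>c>2. \<forall>(S::'a::linorder set) Ls. todolist \<epsilon> S Ls \<longrightarrow>
      supports_within \<epsilon> c (log (2 - \<epsilon>) (real (card S)) + K) S Ls"
    by (rule exI[of _ 4]) (auto intro: todolist_supports)
next
  fix c \<epsilon>\<^sub>0 :: real
  assume c: "c > 2" and \<epsilon>\<^sub>0: "\<epsilon>\<^sub>0 \<in> {0<..<1}"
  then obtain M where M: "2 / (1 - \<epsilon>\<^sub>0) < (2 - \<epsilon>\<^sub>0) ^ M"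
    using real_arch_pow[of "2 - \<epsilon>\<^sub>0" "2 / (1 - \<epsilon>\<^sub>0)"] by auto
  \<comment> \<open>The constants of the locale can be named here, before \<epsilon> is fixed,
    because they depend on \<open>\<epsilon>\<^sub>0\<close> and \<open>c\<close> alone.\<close>
  define C where "C = 2 * todolist_parameters.A \<epsilon>\<^sub>0 +
    todolist_parameters.D \<epsilon>\<^sub>0 c * (1 / ln (2 - \<epsilon>\<^sub>0) + 2 * (M + 3))"
  show "\<exists>K C::real. \<forall>\<epsilon>\<in>{0<..\<epsilon>\<^sub>0}. \<forall>ps::'a op list.
        let R = perform_all \<epsilon> c ps empty_todolist; Ls = result R;
            S = values_after ps; l = log (2 - \<epsilon>) (real (card S)); N = length ps
        in layered S Ls
           \<and> \<bar>real (height Ls) - l\<bar> \<le> K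
           \<and> supports_within \<epsilon> c (l + K) S Ls
           \<and> (N \<ge> 2 \<longrightarrow> real (time R) \<le> C * (1 / \<epsilon>) * real N * ln (real N))"
  \<comment> \<open>The height is off by at most \<open>M + 2\<close>, and the comparison bound
    \<open>height Ls + 2\<close> adds two.\<close>
  proof (rule exI[of _ "real M + 4"], rule exI[of _ C], intro ballI allI)
    fix \<epsilon> :: real and ps :: "'a op list"
    assume \<epsilon>: "\<epsilon> \<in> {0<..\<epsilon>\<^sub>0}"
    interpret todolist_parameters \<epsilon> \<epsilon>\<^sub>0 c M
      using c \<epsilon>\<^sub>0 \<epsilon> M by unfold_locales auto
    note e = perform_all_empty[of ps]
    note h = balanced_height[OF e(2)]
    have "supports_within \<epsilon> c
        (log (2 - \<epsilon>) (card (values_after ps)) + (real M + 4)) (values_after ps)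
        (result (perform_all \<epsilon> c ps empty_todolist))"
    proof (rule supports_within[OF e(1) _ eps(1) eps_less_1])
      show "card (values_after ps) \<le> 2 ^ height (result (perform_all \<epsilon> c ps empty_todolist))"
        using e(2) fits_two_power by (simp add: balanced_def)
    qed (use h in linarith)
    then show "let R = perform_all \<epsilon> c ps empty_todolist; Ls = result R;
            S = values_after ps; l = log (2 - \<epsilon>) (real (card S)); N = length ps
        in layered S Ls
           \<and> \<bar>real (height Ls) - l\<bar> \<le> (real M + 4)
           \<and> supports_within \<epsilon> c (l + (real M + 4)) S Ls
           \<and> (N \<ge> 2 \<longrightarrow> real (time R) \<le> C * (1 / \<epsilon>) * real N * ln (real N))"
      using e h unfolding Let_def C_def by auto
  qed
qed

end
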